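(* Let $n\ge 2$, let $U\subset\mathbb{R}^n$ be open, let $X\in C^2(U,\mathbb{R}^n)$, $p\in U$ with $X(p)=0$, put $J:=DX(p)$, and assume that $\operatorname{rank}J=n-1$, $e_{n-1}(J)=0$ and $e_{n-2}(J)\neq 0$. Let $q_0$ span $\ker J$ and let $(a,b)$ be the Bogdanov--Takens coefficients associated with $(X,p,q_0)$ (defined in the context). Writing $e_k$ for $e_k(J)$ and $D_{q_0}e_k:=\frac{d}{ds}\big|_{s=0}e_k(DX(p+sq_0))$, one has $$D_{q_0}e_n=-2a\,e_{n-2},\qquad D_{q_0}e_{n-1}=b\,e_{n-2}-2a\,e_{n-3},$$ and therefore $$a=-\frac12\,\frac{D_{q_0}e_n}{e_{n-2}},\qquad b=\frac{D_{q_0}e_{n-1}}{e_{n-2}}-\frac{e_{n-3}\,D_{q_0}e_n}{e_{n-2}^2}.$$ If in addition $X\in C^3$ and $J_{\mathrm{tr}}:=J|_{\operatorname{im}J^2}$ is hyperbolic (no eigenvalue with zero real part), then these two numbers are the quadratic coefficients of the Bogdanov--Takens normal form $$\dot u_1=u_2,\qquad \dot u_2=a\,u_1^2+b\,u_1u_2+\mathcal{O}(|u|^3)$$ of the restriction of $X$ to a local centre manifold at $p$, in suitable local coordinates $(u_1,u_2)$ obtained from the chart induced by the basis $(q_0,q_1)$ of $\ker J^2$ by a near-identity quadratic change.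
   Context: For a real $m\times m$ matrix $A$, $e_k(A)$ is the sum of the principal $k\times k$ minors of $A$, so that $\det(\lambda I-A)=\sum_{k=0}^m(-1)^k e_k(A)\lambda^{m-k}$; $e_0(A)=1$ and $e_k(A):=0$ for $k<0$. Under the stated rank and $e_k$ conditions, $0$ is an eigenvalue of $J$ of algebraic multiplicity two and geometric multiplicity one, and $\mathbb{R}^n=E^c\oplus E^{\mathrm{tr}}$ with $E^c:=\ker J^2$, $E^{\mathrm{tr}}:=\operatorname{im}J^2$, both $J$-invariant, $\dim E^c=2$, $J|_{E^c}$ nilpotent of rank one, $J_{\mathrm{tr}}=J|_{E^{\mathrm{tr}}}$ invertible. Definition of $(a,b)$: choose $q_1\in E^c$ with $Jq_1=q_0$; let $p_0,p_1$ be the covectors determined by $\langle p_0,q_0\rangle=\langle p_1,q_1\rangle=1$, $\langle p_0,q_1\rangle=\langle p_1,q_0\rangle=0$, $p_0|_{E^{\mathrm{tr}}}=p_1|_{E^{\mathrm{tr}}}=0$. With $B(u,v):=D^2X(p)[u,v]$, $$a:=\tfrac12\langle p_1,B(q_0,q_0)\rangle,\qquad b:=\langle p_0,B(q_0,q_0)\rangle+\langle p_1,B(q_0,q_1)\rangle .$$ The pair $(a,b)$ does not depend on the choice of $q_1$. A local centre manifold at $p$ is a $C^3$ locally invariant two-dimensional submanifold through $p$ tangent to $E^c$ at $p$, i.e. a graph $\{p+y+h(y)\}$ with $y=y_1q_0+y_2q_1\in E^c$ small, $h:E^c\to E^{\mathrm{tr}}$, $h(0)=0$, $Dh(0)=0$;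 the chart induced by $(q_0,q_1)$ is $(y_1,y_2)$. *)

theory Defs
  imports "HOL-Analysis.Analysis" "HOL-Library.Landau_Symbols"
begin

(* For S open in a finite-dimensional space this is C^k-regularity on S: the iterated
   directional derivatives up to order k exist and are continuous. *)
primrec Ck_on :: "nat \<Rightarrow> ('a::euclidean_space \<Rightarrow> 'b::real_normed_vector) \<Rightarrow> 'a set \<Rightarrow> bool" where
  "Ck_on 0 f S \<longleftrightarrow> continuous_on S f"
| "Ck_on (Suc k) f S \<longleftrightarrow>
     (\<forall>x\<in>S. f differentiable (at x)) \<and>
     (\<forall>v. Ck_on k (\<lambda>x. frechet_derivative f (at x) v) S)"

definition second_derivative ::
    "('a::real_normed_vector \<Rightarrow> 'b::real_normed_vector) \<Rightarrow> 'a \<Rightarrow> 'a \<Rightarrow> 'a \<Rightarrow> 'b" where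
  "second_derivative f x u v = frechet_derivative (\<lambda>z. frechet_derivative f (at z) v) (at x) u"

(* Leibniz formula for the determinant of the submatrix with rows and columns in S. *)
definition principal_minor :: "real^'n^'n \<Rightarrow> 'n set \<Rightarrow> real" where
  "principal_minor A S = (\<Sum>\<sigma> | \<sigma> permutes S. of_int (sign \<sigma>) * (\<Prod>i\<in>S. A $ i $ \<sigma> i))"

lemma principal_minor_UNIV: "principal_minor A UNIV = det A"
  by (simp add: principal_minor_def det_def)

definition e_sum :: "int \<Rightarrow> real^'n^'n \<Rightarrow> real" where
  "e_sum k A = (if k < 0 then 0 else (\<Sum>S | card S = nat k. principal_minor A S))"

lemma e_sum_0: "e_sum 0 (A::real^'n^'n) = 1"
proof -
  have "{S::'n set. card S = 0} = {{}}" by (simp add: card_eq_0_iff)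
  moreover have "{\<sigma>::'n \<Rightarrow> 'n. \<sigma> permutes {}} = {id}" by auto
  ultimately show ?thesis by (simp add: e_sum_def principal_minor_def)
qed

lemma e_sum_CARD: "e_sum (int CARD('n)) (A::real^'n^'n) = det A"
proof -
  have "{S::'n set. card S = CARD('n)} = {UNIV}"
    by (auto dest: card_eq_UNIV_imp_eq_UNIV[rotated])
  then show ?thesis by (simp add: e_sum_def principal_minor_UNIV)
qed

definition E_c :: "real^'n^'n \<Rightarrow> (real^'n) set" where
  "E_c J = {v. J *v (J *v v) = 0}"

definition E_tr :: "real^'n^'n \<Rightarrow> (real^'n) set" where
  "E_tr J = range (\<lambda>v. J *v (J *v v))"

(* Covectors are linear functionals. *)
definition bt_frame ::
    "real^'n^'n \<Rightarrow> real^'n \<Rightarrow> real^'n \<Rightarrow> (real^'n \<Rightarrow> real) \<Rightarrow> (real^'n \<Rightarrow> real) \<Rightarrow> bool" where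
  "bt_frame J q0 q1 p0 p1 \<longleftrightarrow>
     q1 \<in> E_c J \<and> J *v q1 = q0 \<and> linear p0 \<and> linear p1 \<and>
     p0 q0 = 1 \<and> p1 q1 = 1 \<and> p0 q1 = 0 \<and> p1 q0 = 0 \<and>
     (\<forall>v\<in>E_tr J. p0 v = 0 \<and> p1 v = 0)"

(* The pair is independent of the choice of the frame, so the description is definite. *)
definition bt_coeffs :: "(real^'n \<Rightarrow> real^'n) \<Rightarrow> real^'n \<Rightarrow> real^'n \<Rightarrow> real \<times> real" where
  "bt_coeffs X p q0 = (THE ab. \<exists>q1 p0 p1.
     bt_frame (jacobian X (at p)) q0 q1 p0 p1 \<and>
     ab = (1/2 * p1 (second_derivative X p q0 q0),
           p0 (second_derivative X p q0 q0) + p1 (second_derivative X p q0 q1)))"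

(* w lies in the complexification of the real subspace E, and J acts on it through its
   complexification. *)
definition eigenvalue_on :: "real^'n^'n \<Rightarrow> (real^'n) set \<Rightarrow> complex \<Rightarrow> bool" where
  "eigenvalue_on J E \<mu> \<longleftrightarrow> (\<exists>w::complex^'n. w \<noteq> 0 \<and>
     (\<chi> i. Re (w $ i)) \<in> E \<and> (\<chi> i. Im (w $ i)) \<in> E \<and>
     (\<chi> i j. complex_of_real (J $ i $ j)) *v w = \<mu> *s w)"

definition hyperbolic_on :: "real^'n^'n \<Rightarrow> (real^'n) set \<Rightarrow> bool" where
  "hyperbolic_on J E \<longleftrightarrow> (\<forall>\<mu>. eigenvalue_on J E \<mu> \<longrightarrow> Re \<mu> \<noteq> 0)"

definition locally_invariant :: "('a::real_normed_vector \<Rightarrow> 'a) \<Rightarrow> 'a set \<Rightarrow> bool" where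
  "locally_invariant X M \<longleftrightarrow> (\<forall>z\<in>M. \<exists>\<epsilon>>0. \<exists>x. x 0 = z \<and>
     (\<forall>t\<in>{-\<epsilon><..<\<epsilon>}. (x has_vector_derivative X (x t)) (at t) \<and> x t \<in> M))"

definition graph_param ::
    "real^'n \<Rightarrow> real^'n \<Rightarrow> real^'n \<Rightarrow> (real \<times> real \<Rightarrow> real^'n) \<Rightarrow> real \<times> real \<Rightarrow> real^'n" where
  "graph_param p q0 q1 h y = p + (fst y *\<^sub>R q0 + snd y *\<^sub>R q1) + h y"

(* h is written in the coordinates (y1, y2) of the vector y1 q0 + y2 q1 of E_c;
   the manifold is the image of V under graph_param. *)
definition local_centre_manifold ::
    "(real^'n \<Rightarrow> real^'n) \<Rightarrow> (real^'n) set \<Rightarrow> real^'n \<Rightarrow> real^'n \<Rightarrow> real^'n \<Rightarrow>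
     (real \<times> real) set \<Rightarrow> (real \<times> real \<Rightarrow> real^'n) \<Rightarrow> bool" where
  "local_centre_manifold X U p q0 q1 V h \<longleftrightarrow>
     open V \<and> 0 \<in> V \<and> Ck_on 3 h V \<and>
     (\<forall>y\<in>V. h y \<in> E_tr (jacobian X (at p))) \<and>
     h 0 = 0 \<and> (h has_derivative (\<lambda>_. 0)) (at 0) \<and>
     graph_param p q0 q1 h ` V \<subseteq> U \<and>
     locally_invariant X (graph_param p q0 q1 h ` V)"

(* D\<phi>(y) Y(y) = Z(\<phi>(y)).  If \<phi> parametrizes an invariant manifold of Z, then Y is the
   restriction of Z in the chart inverse to \<phi>; if \<phi> is a change of coordinates, then Z is Y in
   the new coordinates. *)
definition vf_related ::
    "('a::real_normed_vector \<Rightarrow> 'b::real_normed_vector) \<Rightarrow> 'a set \<Rightarrow> ('a \<Rightarrow> 'a) \<Rightarrow> ('b \<Rightarrow> 'b) \<Rightarrow> bool" where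
  "vf_related \<phi> N Y Z \<longleftrightarrow>
     (\<forall>y\<in>N. \<phi> differentiable (at y) \<and> frechet_derivative \<phi> (at y) (Y y) = Z (\<phi> y))"

definition homogeneous_quadratic :: "('a::real_vector \<Rightarrow> 'b::real_vector) \<Rightarrow> bool" where
  "homogeneous_quadratic Q \<longleftrightarrow> (\<exists>B. bilinear B \<and> (\<forall>y. Q y = B y y))"

definition local_coordinates :: "(real \<times> real \<Rightarrow> real \<times> real) \<Rightarrow> (real \<times> real) set \<Rightarrow> bool" where
  "local_coordinates \<Psi> N \<longleftrightarrow> open N \<and> 0 \<in> N \<and> Ck_on 3 \<Psi> N \<and> \<Psi> 0 = 0 \<and> inj_on \<Psi> N \<and>
     (\<forall>y\<in>N. bij (frechet_derivative \<Psi> (at y)))"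

definition bt_field_mod_cubic :: "real \<Rightarrow> real \<Rightarrow> (real \<times> real \<Rightarrow> real \<times> real) \<Rightarrow> bool" where
  "bt_field_mod_cubic a b Z \<longleftrightarrow>
     (\<lambda>u. fst (Z u) - snd u) \<in> O[at 0](\<lambda>u. norm u ^ 3) \<and>
     (\<lambda>u. snd (Z u) - (a * (fst u)\<^sup>2 + b * fst u * snd u)) \<in> O[at 0](\<lambda>u. norm u ^ 3)"

(* A purely quadratic change yields the normal form with a cubic remainder also in the first
   equation.  The exact first equation u1' = u2 in general needs a further cubic-order term r in
   the change.  Both forms are asserted, with the same quadratic part Q. *)
definition bt_normal_form ::
    "real \<Rightarrow> real \<Rightarrow> (real \<times> real \<Rightarrow> real \<times> real) \<Rightarrow> (real \<times> real) set \<Rightarrow> bool" where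
  "bt_normal_form a b Y V \<longleftrightarrow> (\<exists>Q. homogeneous_quadratic Q \<and>
     (\<exists>N Z. N \<subseteq> V \<and> local_coordinates (\<lambda>y. y + Q y) N \<and>
        vf_related (\<lambda>y. y + Q y) N Y Z \<and> bt_field_mod_cubic a b Z) \<and>
     (\<exists>r N Z. N \<subseteq> V \<and> (\<lambda>y. norm (r y)) \<in> O[at 0](\<lambda>y. norm y ^ 3) \<and>
        local_coordinates (\<lambda>y. y + Q y + r y) N \<and>
        vf_related (\<lambda>y. y + Q y + r y) N Y Z \<and>
        (\<forall>u\<in>(\<lambda>y. y + Q y + r y) ` N. fst (Z u) = snd u) \<and> bt_field_mod_cubic a b Z))"

end

(* The polynomial det (l I + DX(p + s q0)) in l has coefficients e_k, and its s-derivative at s = 0 is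
   the trace of adj (l I + J) composed with B(q0, .).  On q0 and q1 the adjugate is explicit, because
   adj (l I + J) (l I + J) = det (l I + J) I with det (l I + J) = l^2 (e_{n-2} + e_{n-3} l + ...), and on
   im J^2 it is O(l^2).  Comparing the coefficients of l^0 and l^1 gives both derivative formulas, and
   these formulas also show that (a, b) does not depend on the frame.

   On a centre manifold, p0 and p1 recover the coordinates (y1, y2) and annihilate the graph function,
   so the restricted field is (p0 X, p1 X) along the graph.  As h = O(|y|^2) takes values in im J^2, it
   contributes only at third order, and the 2-jet of the field is (y2 + p0 B(y,y)/2, p1 B(y,y)/2).  The
   change u1 = y1 + alpha y1^2, u2 = (d/dt) u1 truncated at order two, or taken exactly, yields the
   normal form; alpha is chosen to remove the u2^2 term of the second equation. *)
theory Submission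
  imports Defs "HOL-Computational_Algebra.Polynomial"
begin

text \<open>Neither the splitting of R^n nor a Jordan chain is given, only the rank and two
  coefficients. The structure is extracted from N(l) = adj (l I + J): its entries are continuous at
  l = 0, while N(l) (l I + J) = l^2 g(l) I with g(0) = e_{n-2} nonzero. Both ways in which the chain
  q0, q1 could fail contradict this: without a q1 the matrix N(l) has half the trace it must have,
  and with a third link it is unbounded. Relations hold first for l nonzero, after division by l,
  and are carried to l = 0 by continuity.

  The normal form has an obstacle of its own. The exact equation u1' = u2 needs a correction that is
  O(|y|^3), and the transformed field contains the derivative of that correction. A bound on a
  function does not bound its derivative in general; here it does, because the third derivatives are
  locally bounded. The error estimates must also pass from y to the new coordinates, for which a
  lower bound on the size of the change serves in place of an inverse map.\<close>

section \<open>Principal minors and the adjugate\<close>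

text \<open>Each Leibniz product is multiplied out over the set S of rows that contribute an entry
  of A; every other row contributes l times a Kronecker delta. That factor survives only if sigma
  fixes the complement of S, that is, if sigma permutes S, so the sum over sigma collapses to a
  principal minor.\<close>

lemma det_mat_add_principal_minors:
  fixes A :: "real^'n^'n"
  shows "det (mat l + A) = (\<Sum>S\<in>UNIV. l ^ (CARD('n) - card S) * principal_minor A S)"
proof -
  have outside: "(\<Prod>i\<in>-S. if i = \<sigma> i then l else 0)
      = (if \<sigma> permutes S then l ^ (CARD('n) - card S) else 0)"
    if perm: "\<sigma> permutes UNIV" for \<sigma> :: "'n \<Rightarrow> 'n" and S
  proof (cases "\<sigma> permutes S")
    case True
    then have "\<And>i. i \<in> -S \<Longrightarrow> i = \<sigma> i"
      by (simp add: permutes_not_in)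
    then have "(\<Prod>i\<in>-S. if i = \<sigma> i then l else 0) = (\<Prod>i\<in>-S. l)"
      by (intro prod.cong) auto
    with True show ?thesis
      by (simp add: card_Diff_subset Compl_eq_Diff_UNIV)
  next
    case False
    then obtain i where "i \<in> -S" "i \<noteq> \<sigma> i"
      using permutes_superset[OF perm] by (metis ComplI DiffD2)
    then have "(\<Prod>i\<in>-S. if i = \<sigma> i then l else 0) = 0"
      by (intro prod_zero) auto
    with False show ?thesis by simp
  qed
  have sub: "{\<sigma>. \<sigma> permutes S} \<subseteq> {\<sigma>. \<sigma> permutes UNIV}" for S :: "'n set"
    using permutes_subset by blast
  have fin: "finite {\<sigma>::'n \<Rightarrow> 'n. \<sigma> permutes UNIV}"
    by (simp add: finite_permutations)
  have "det (mat l + A) = (\<Sum>\<sigma> | \<sigma> permutes UNIV. of_int (sign \<sigma>) *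
      (\<Prod>i\<in>UNIV. A $ i $ \<sigma> i + (if i = \<sigma> i then l else 0)))"
    by (simp add: det_def mat_def add.commute)
  also have "\<dots> = (\<Sum>\<sigma> | \<sigma> permutes UNIV. of_int (sign \<sigma>) *
      (\<Sum>S\<in>UNIV. (\<Prod>i\<in>S. A $ i $ \<sigma> i) * (\<Prod>i\<in>-S. if i = \<sigma> i then l else 0)))"
    by (simp add: prod_add Compl_eq_Diff_UNIV)
  also have "\<dots> = (\<Sum>S\<in>UNIV. \<Sum>\<sigma> | \<sigma> permutes UNIV. of_int (sign \<sigma>) *
      ((\<Prod>i\<in>S. A $ i $ \<sigma> i) * (\<Prod>i\<in>-S. if i = \<sigma> i then l else 0)))"
    by (simp add: sum_distrib_left) (rule sum.swap)
  also have "\<dots> = (\<Sum>S\<in>UNIV. \<Sum>\<sigma> | \<sigma> permutes S. of_int (sign \<sigma>) *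
      ((\<Prod>i\<in>S. A $ i $ \<sigma> i) * l ^ (CARD('n) - card S)))"
    by (intro sum.cong refl sum.mono_neutral_cong_right fin sub) (auto simp: outside sub permutes_subset)
  also have "\<dots> = (\<Sum>S\<in>UNIV. l ^ (CARD('n) - card S) * principal_minor A S)"
    by (simp add: principal_minor_def sum_distrib_left ac_simps)
  finally show ?thesis .
qed

definition minor_poly :: "real^'n^'n \<Rightarrow> real poly" where
  "minor_poly A = (\<Sum>i\<le>CARD('n). monom (e_sum (int CARD('n) - int i) A) i)"

text \<open>True for every i: above the degree the index of \<open>e_sum\<close> is negative and
  both sides are 0.\<close>

lemma coeff_minor_poly: "coeff (minor_poly (A::real^'n^'n)) i = e_sum (int CARD('n) - int i) A"
  by (auto simp: minor_poly_def coeff_sum e_sum_def)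

lemma poly_minor_poly: "poly (minor_poly (A::real^'n^'n)) l = det (mat l + A)"
proof -
  let ?n = "CARD('n)"
  have card_le: "card S \<le> ?n" for S :: "'n set"
    by (simp add: card_mono)
  have "det (mat l + A) = (\<Sum>k\<in>{..?n}. \<Sum>S\<in>{S\<in>UNIV. card S = k}.
      l ^ (?n - card S) * principal_minor A S)"
    unfolding det_mat_add_principal_minors
    by (rule sum.group[symmetric]) (auto simp: card_le)
  also have "\<dots> = (\<Sum>k\<le>?n. e_sum (int k) A * l ^ (?n - k))"
    by (intro sum.cong refl) (auto simp: e_sum_def sum_distrib_left mult.commute)
  also have "\<dots> = (\<Sum>i\<le>?n. e_sum (int ?n - int i) A * l ^ i)"
    by (rule sum.reindex_bij_witness[of _ "\<lambda>i. ?n - i" "\<lambda>i. ?n - i"]) auto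
  also have "\<dots> = poly (minor_poly A) l"
    by (simp add: minor_poly_def poly_sum poly_monom)
  finally show ?thesis by simp
qed

text \<open>The numerator in Cramer's rule, hence component k of the adjugate applied to v. With the
  adjugate defined from it, \<open>cramer_lemma\<close> becomes the identity adj(A) A = det(A)
  I.\<close>

definition column_replaced_det :: "real^'n^'n \<Rightarrow> real^'n \<Rightarrow> 'n \<Rightarrow> real" where
  "column_replaced_det A v k = det (\<chi> i j. if j = k then v $ i else A $ i $ j)"

lemma linear_column_replaced_det: "linear (\<lambda>v. column_replaced_det A v k)"
proof -
  \<comment> \<open>The multilinearity rules for \<open>det\<close> speak of rows, so the replaced
    column is turned into a row by transposition.\<close>
  have *: "column_replaced_det A v k
      = det (\<chi> i. if i = k then v else row i (transpose A))" for v
    unfolding column_replaced_det_def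
    by (subst det_transpose[symmetric], rule arg_cong[of _ _ det])
      (auto simp: vec_eq_iff transpose_def row_def)
  show ?thesis
    unfolding * linear_iff scalar_mult_eq_scaleR[symmetric]
    using det_row_add[of k "\<lambda>_. _" "\<lambda>_. _" "\<lambda>i. row i (transpose A)"]
      det_row_mul[of k _ "\<lambda>_. _" "\<lambda>i. row i (transpose A)"]
    by auto
qed

definition adjugate :: "real^'n^'n \<Rightarrow> real^'n^'n" where
  "adjugate A = matrix (\<lambda>v. \<chi> k. column_replaced_det A v k)"

lemma adjugate_mult: "adjugate A *v v = (\<chi> k. column_replaced_det A v k)"
proof -
  have "linear (\<lambda>v. \<chi> k. column_replaced_det A v k)"
    using linear_column_replaced_det[of A] by (auto simp: linear_iff vec_eq_iff)
  then show ?thesis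
    unfolding adjugate_def by (metis matrix_vector_mul(2))
qed

lemma adjugate_mult_self: "adjugate A *v (A *v x) = det A *\<^sub>R x"
  by (simp add: adjugate_mult column_replaced_det_def cramer_lemma vec_eq_iff)

text \<open>Jacobi's formula. The product rule differentiates one factor of each Leibniz product;
  the terms whose differentiated factor lies in column k add up to the determinant with column k
  replaced by that of C, which is the k-th diagonal entry of adj times C. The transpose makes the
  Leibniz product run over columns.\<close>

lemma has_real_derivative_det:
  fixes A :: "real \<Rightarrow> real^'n^'n"
  assumes "\<And>i j. ((\<lambda>s. A s $ i $ j) has_real_derivative C $ i $ j) (at t)"
  shows "((\<lambda>s. det (A s)) has_real_derivative trace (adjugate (A t) ** C)) (at t)"
proof -
  have col: "(\<Sum>\<sigma> | \<sigma> permutes UNIV. of_int (sign \<sigma>) *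
      (C $ \<sigma> k $ k * (\<Prod>i\<in>UNIV-{k}. A t $ \<sigma> i $ i)))
      = column_replaced_det (A t) (column k C) k" for k
  proof -
    have "column_replaced_det (A t) (column k C) k = det (\<chi> i. if i = k then column k C else column i (A t))"
      unfolding column_replaced_det_def
      by (subst det_transpose[symmetric], rule arg_cong[of _ _ det])
        (auto simp: vec_eq_iff transpose_def column_def)
    also have "\<dots> = (\<Sum>\<sigma> | \<sigma> permutes UNIV. of_int (sign \<sigma>) *
      (\<Prod>i\<in>UNIV. (if i = k then column k C else column i (A t)) $ \<sigma> i))"
      by (simp add: det_def)
    also have "\<dots> = (\<Sum>\<sigma> | \<sigma> permutes UNIV. of_int (sign \<sigma>) *
      (C $ \<sigma> k $ k * (\<Prod>i\<in>UNIV-{k}. A t $ \<sigma> i $ i)))"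
      by (intro sum.cong refl, subst prod.remove[of UNIV k])
        (auto simp: column_def intro!: prod.cong)
    finally show ?thesis by simp
  qed
  have "((\<lambda>s. det (transpose (A s))) has_real_derivative
     (\<Sum>\<sigma> | \<sigma> permutes UNIV. of_int (sign \<sigma>) *
       (\<Sum>k\<in>UNIV. C $ \<sigma> k $ k * (\<Prod>i\<in>UNIV-{k}. A t $ \<sigma> i $ i)))) (at t)"
    unfolding det_def transpose_def vec_lambda_beta
    by (intro DERIV_sum DERIV_cmult has_field_derivative_prod assms)
  also have "(\<Sum>\<sigma> | \<sigma> permutes UNIV. of_int (sign \<sigma>) *
       (\<Sum>k\<in>UNIV. C $ \<sigma> k $ k * (\<Prod>i\<in>UNIV-{k}. A t $ \<sigma> i $ i)))
       = (\<Sum>k\<in>UNIV. column_replaced_det (A t) (column k C) k)"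
    unfolding col[symmetric] sum_distrib_left by (rule sum.swap)
  also have "\<dots> = (\<Sum>k\<in>UNIV. (adjugate (A t) *v column k C) $ k)"
    by (simp add: adjugate_mult)
  also have "\<dots> = trace (adjugate (A t) ** C)"
    by (simp add: trace_def matrix_matrix_mult_def matrix_vector_mult_def column_def)
  finally show ?thesis by simp
qed

lemma continuous_adjugate_mult:
  "continuous_on UNIV (\<lambda>l. adjugate (mat l + J) *v v)"
proof -
  have "continuous_on UNIV (\<lambda>l. (\<chi> i j. if j = k then v $ i else (mat l + J) $ i $ j) $ i $ j)" for i j k
    by (cases "j = k"; cases "i = j") (auto simp: mat_def intro!: continuous_intros)
  note entry = this[unfolded vec_lambda_beta]
  show ?thesis
    unfolding adjugate_mult column_replaced_det_def det_def vec_lambda_beta by (intro continuous_intros entry)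
qed

lemma mat_add_mult: "(mat l + J) *v v = l *\<^sub>R v + J *v (v::real^'n)"
proof -
  have "mat l = l *\<^sub>R (mat 1 :: real^'n^'n)"
    by (simp add: vec_eq_iff mat_def)
  then show ?thesis
    by (simp add: matrix_vector_mult_add_rdistrib scaleR_matrix_vector_assoc[symmetric])
qed

lemma trace_eq_sum_axis: "trace (N ** C) = (\<Sum>i\<in>UNIV. (N *v (C *v axis i (1::real))) $ i)"
  by (simp add: trace_def matrix_vector_mult_basis)
    (simp add: column_def matrix_matrix_mult_def matrix_vector_mult_def)

lemma axis_expansion: "(\<Sum>i\<in>UNIV. x $ i *\<^sub>R axis i (1::real)) = x"
  unfolding scalar_mult_eq_scaleR[symmetric] by (rule basis_expansion)

text \<open>The sum is the trace of the rank-one map sending v to f(v) x. It evaluates the q0 and q1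
  parts of a trace taken in the standard basis, without a change of basis.\<close>

lemma sum_axis_linear:
  fixes f :: "real^'n \<Rightarrow> real"
  assumes "linear f"
  shows "(\<Sum>i\<in>UNIV. f (axis i 1) * x $ i) = f x"
proof -
  have "f x = f (\<Sum>i\<in>UNIV. x $ i *\<^sub>R axis i 1)"
    by (simp only: axis_expansion)
  also have "\<dots> = (\<Sum>i\<in>UNIV. f (axis i 1) * x $ i)"
    by (simp add: linear_sum[OF assms] linear_scale[OF assms] mult.commute)
  finally show ?thesis by simp
qed

text \<open>A substitute for comparing the coefficients of 1 and l when the identity is known only
  for l nonzero and H is merely continuous at 0.\<close>

lemma vanishing_low_order:
  fixes H :: "real \<Rightarrow> real"
  assumes "isCont H 0" and "\<And>l. l \<noteq> 0 \<Longrightarrow> c + l * H l = 0"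
  shows "c = 0" and "H 0 = 0"
proof -
  have "((\<lambda>l. c + l * H l) \<longlongrightarrow> c + 0 * H 0) (at 0)"
    using assms(1) by (intro tendsto_intros) (simp add: isCont_def)
  moreover have "((\<lambda>l. c + l * H l) \<longlongrightarrow> 0) (at 0)"
    by (rule tendsto_eventually) (auto simp: eventually_at_filter assms(2))
  ultimately show c: "c = 0"
    using tendsto_unique[of "at (0::real)"] by simp
  have "(H \<longlongrightarrow> 0) (at 0)"
    by (rule tendsto_eventually) (use assms(2) c in \<open>auto simp: eventually_at_filter\<close>)
  with assms(1) show "H 0 = 0"
    using tendsto_unique[of "at (0::real)"] by (simp add: isCont_def)
qed

section \<open>The Jordan block at zero and its complement, read off from the adjugate\<close>

locale bogdanov_takens =
  fixes J :: "real^'n^'n" and q0 :: "real^'n"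
  assumes rank_J: "int (rank J) = int CARD('n) - 1"
    and e_n1: "e_sum (int CARD('n) - 1) J = 0"
    and e_n2: "e_sum (int CARD('n) - 2) J \<noteq> 0"
    and ker_J: "span {q0} = {v. J *v v = 0}"
begin

definition N :: "real \<Rightarrow> real^'n^'n" where "N l = adjugate (mat l + J)"

text \<open>This is det (l I + J) divided by l^2: the shift discards only the coefficients e_n and
  e_{n-1}, which both vanish.\<close>

definition g :: "real poly" where
  "g = poly_shift 2 (minor_poly J)"

lemma coeff_g: "coeff g i = e_sum (int CARD('n) - 2 - int i) J"
  by (simp add: g_def coeff_poly_shift coeff_minor_poly algebra_simps)

lemma q0_nonzero: "q0 \<noteq> 0"
proof
  assume "q0 = 0"
  with ker_J have "\<not> (\<exists>x. x \<noteq> 0 \<and> J *v x = 0)" by auto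
  then show False
    using rank_J matrix_nonfull_linear_equations_eq[of J] by simp
qed

lemma J_q0: "J *v q0 = 0"
  using ker_J span_base[of q0 "{q0}"] by auto

lemma det_mat_add: "det (mat l + J) = l\<^sup>2 * poly g l"
proof -
  have "e_sum (int CARD('n)) J = 0"
    using J_q0 q0_nonzero matrix_left_invertible_ker[of J] by (auto simp: e_sum_CARD invertible_det_nz[symmetric] invertible_left_inverse)
  then have "minor_poly J = monom 1 2 * g"
    using e_n1
    by (auto simp: poly_eq_iff coeff_minor_poly coeff_monom_mult coeff_g less_Suc_eq numeral_2_eq_2
        not_less_eq[symmetric] of_nat_diff not_less)
  then show ?thesis
    by (simp add: poly_minor_poly[symmetric] poly_monom)
qed

text \<open>Each application of J gains a factor l: N(l) is O(l) on the range of J, and iterating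
  gives O(l^2) on the range of J^2.\<close>

lemma N_J: "N l *v (J *v v) = (l\<^sup>2 * poly g l) *\<^sub>R v - l *\<^sub>R (N l *v v)"
  using adjugate_mult_self[of "mat l + J" v]
  unfolding N_def[symmetric] det_mat_add mat_add_mult matrix_vector_right_distrib
    matrix_vector_mult_scaleR
  by (simp add: eq_diff_eq add.commute)

lemma N_q0: "l \<noteq> 0 \<Longrightarrow> N l *v q0 = (l * poly g l) *\<^sub>R q0"
  using N_J[of l q0] by (simp add: J_q0 power2_eq_square scaleR_scaleR[symmetric] del: scaleR_scaleR)

text \<open>The term - g(l) q0 has order 0 in l. It is the part of N(l) through which
  \<open>p1\<close> of B(q0, q0) enters the coefficient of l^0.\<close>

lemma N_q1:
  assumes "J *v q1 = q0" "l \<noteq> 0"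
  shows "N l *v q1 = (l * poly g l) *\<^sub>R q1 - poly g l *\<^sub>R q0"
proof -
  have "l *\<^sub>R (N l *v q1) = l *\<^sub>R ((l * poly g l) *\<^sub>R q1 - poly g l *\<^sub>R q0)"
    using N_J[of l q1] assms(2) unfolding assms(1) N_q0[OF assms(2)]
    by (simp add: algebra_simps power2_eq_square)
  with assms(2) show ?thesis by simp
qed

lemma isCont_N: "isCont (\<lambda>l. (N l *v v) $ i) 0"
  using continuous_adjugate_mult[of J v]
  by (auto simp: N_def continuous_on_eq_continuous_at intro!: continuous_intros)

lemmas isCont_rules = continuous_add continuous_diff continuous_mult continuous_sum continuous_power
  continuous_const continuous_ident poly_isCont isCont_N

lemma poly_g_0: "poly g 0 \<noteq> 0"
  using e_n2 by (simp add: poly_0_coeff_0 coeff_g)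

text \<open>The rank hypothesis makes the range a hyperplane, so one vector outside it spans a
  complement. It is used with q0, inside a proof by contradiction, and with q1.\<close>

lemma complement_of_range:
  assumes "x \<notin> range ((*v) J)"
  obtains \<alpha> w where "v = \<alpha> *\<^sub>R x + J *v w"
proof -
  have sub: "subspace (range ((*v) J))"
    by (simp add: linear_subspace_image)
  have "dim (insert x (range ((*v) J))) = CARD('n)"
    using rank_J assms unfolding dim_insert span_eq_iff[THEN iffD2, OF sub]
    by (simp add: rank_dim_range)
  then have "v \<in> span (insert x (range ((*v) J)))"
    using dim_eq_full[of "insert x (range ((*v) J))"] by simp
  then obtain k where "v - k *\<^sub>R x \<in> range ((*v) J)"
    unfolding span_insert span_eq_iff[THEN iffD2, OF sub] by blast
  then show ?thesis
    using that[of k] by (metis add.commute diff_add_cancel rangeE)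
qed

lemma range_scaleR_cancel:
  assumes "c *\<^sub>R x = J *v y" "c \<noteq> 0"
  shows "x \<in> range ((*v) J)"
proof -
  have "J *v (inverse c *\<^sub>R y) = inverse c *\<^sub>R (c *\<^sub>R x)"
    by (simp only: matrix_vector_mult_scaleR assms(1))
  then show ?thesis
    using assms(2) by (metis rangeI scaleR_one scaleR_scaleR left_inverse)
qed

(* If q0 were not in the range, N(l)/l would tend to e_{n-2} times the projection onto q0 along the
   range, which has trace e_{n-2}; but its trace is (d/dl det (l I + J))/l, which tends to 2 e_{n-2}. *)
lemma q0_in_range: "q0 \<in> range ((*v) J)"
proof (rule ccontr)
  assume nr: "q0 \<notin> range ((*v) J)"
  have "\<exists>\<alpha> w. axis i 1 = \<alpha> *\<^sub>R q0 + J *v w" for i :: 'n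
    by (rule complement_of_range[OF nr]) blast
  then obtain \<alpha> w where aw: "\<And>i::'n. axis i 1 = \<alpha> i *\<^sub>R q0 + J *v w i"
    by metis
  \<comment> \<open>The sum is the trace of the projection onto q0 along the range. Expanding q0
    itself puts (1 - sum) q0 into the range, so the sum must be 1.\<close>
  have beta: "(\<Sum>i\<in>UNIV. \<alpha> i * q0 $ i) = 1"
  proof (rule ccontr)
    let ?b = "\<Sum>i\<in>UNIV. \<alpha> i * q0 $ i"
    assume "?b \<noteq> 1"
    have Jw: "J *v (\<Sum>i\<in>UNIV. q0 $ i *\<^sub>R w i) = (\<Sum>i\<in>UNIV. q0 $ i *\<^sub>R (J *v w i))"
      using linear_sum[OF matrix_vector_mul_linear, of J "\<lambda>i. q0 $ i *\<^sub>R w i" UNIV]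
      by (simp only: matrix_vector_mult_scaleR)
    have "q0 = (\<Sum>i\<in>UNIV. q0 $ i *\<^sub>R axis i 1)"
      by (simp only: axis_expansion)
    also have "\<dots> = (\<Sum>i\<in>UNIV. (\<alpha> i * q0 $ i) *\<^sub>R q0 + q0 $ i *\<^sub>R (J *v w i))"
      by (simp only: aw scaleR_add_right scaleR_scaleR mult.commute)
    also have "\<dots> = ?b *\<^sub>R q0 + J *v (\<Sum>i\<in>UNIV. q0 $ i *\<^sub>R w i)"
      by (simp only: sum.distrib scaleR_sum_left Jw)
    finally have "(1 - ?b) *\<^sub>R q0 = J *v (\<Sum>i\<in>UNIV. q0 $ i *\<^sub>R w i)"
      by (simp add: algebra_simps)
    then have "q0 \<in> range ((*v) J)"
      by (rule range_scaleR_cancel) (use \<open>?b \<noteq> 1\<close> in simp)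
    with nr show False by blast
  qed
  \<comment> \<open>K(l) is (d/dl det (l I + J) - trace N(l)) / l, with the division by l carried
    out symbolically so that K is continuous at 0.\<close>
  define K where "K l = poly g l + l * poly (pderiv g) l
      - (\<Sum>i\<in>UNIV. l * poly g l * w i $ i - (N l *v w i) $ i)" for l
  have K: "K l = 0" if "l \<noteq> 0" for l
  proof -
    have "((\<lambda>l. det (mat l + J)) has_real_derivative trace (N l ** mat 1)) (at l)"
      unfolding N_def by (rule has_real_derivative_det) (auto simp: mat_def intro!: derivative_eq_intros)
    moreover have "((\<lambda>l. det (mat l + J)) has_real_derivative 2 * l * poly g l + l\<^sup>2 * poly (pderiv g) l) (at l)"
      unfolding det_mat_add by (auto intro!: derivative_eq_intros poly_DERIV)
    ultimately have "2 * l * poly g l + l\<^sup>2 * poly (pderiv g) l = trace (N l ** mat 1)"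
      by (rule DERIV_unique[rotated])
    also have "\<dots> = (\<Sum>i\<in>UNIV. (N l *v axis i 1) $ i)"
      by (simp only: trace_eq_sum_axis matrix_vector_mul_lid)
    also have "\<dots> = (\<Sum>i\<in>UNIV. l * poly g l * (\<alpha> i * q0 $ i) +
        l * (l * poly g l * w i $ i - (N l *v w i) $ i))"
      unfolding aw matrix_vector_right_distrib matrix_vector_mult_scaleR N_q0[OF that] N_J
      by (simp add: algebra_simps power2_eq_square)
    also have "\<dots> = l * poly g l + l * (\<Sum>i\<in>UNIV. l * poly g l * w i $ i - (N l *v w i) $ i)"
      using beta by (simp add: sum.distrib flip: sum_distrib_left)
    finally have "l * K l = 0"
      by (simp add: K_def algebra_simps power2_eq_square)
    with that show ?thesis by simp
  qed
  have "isCont K 0"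
    unfolding K_def by (intro isCont_rules)
  then have "K 0 = 0"
    using K by (intro vanishing_low_order(2)[of K 0]) auto
  \<comment> \<open>N(l) is O(l) both on q0 and on the range, which together span the space. Hence
    K(0) reduces to g(0), which is nonzero.\<close>
  have "(N 0 *v v) = 0" for v
  proof -
    obtain a u where v: "v = a *\<^sub>R q0 + J *v u"
      using complement_of_range[OF nr] .
    have "(N 0 *v v) $ i = 0" for i
    proof -
      define H where "H l = a * (l * poly g l * q0 $ i) + (l\<^sup>2 * poly g l * u $ i - l * (N l *v u) $ i)
        - (N l *v v) $ i" for l
      have "H l = 0" if "l \<noteq> 0" for l
        using that unfolding v H_def
        by (simp add: matrix_vector_right_distrib matrix_vector_mult_scaleR N_q0 N_J)
      moreover have "isCont H 0"
        unfolding H_def by (intro isCont_rules)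
      ultimately have "H 0 = 0"
        by (intro vanishing_low_order(2)[of H 0]) auto
      then show ?thesis by (simp add: H_def)
    qed
    then show ?thesis by (simp add: vec_eq_iff)
  qed
  with \<open>K 0 = 0\<close> show False
    using poly_g_0 by (simp add: K_def)
qed

(* Otherwise q1 = J q2, and N(l) maps q2 to a term of order 1/l. *)
lemma q1_notin_range:
  assumes "J *v q1 = q0"
  shows "q1 \<notin> range ((*v) J)"
proof
  assume "q1 \<in> range ((*v) J)"
  then obtain q2 where q2: "q1 = J *v q2" by blast
  have "poly g 0 *\<^sub>R q0 = 0"
  proof (subst vec_eq_iff, rule allI)
    fix i
    \<comment> \<open>Equating \<open>N_J\<close> at q2 with \<open>N_q1\<close> and solving for
      g(l) q0 leaves - l H(l), which tends to 0.\<close>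
    define H where "H l = l * poly g l * q2 $ i - poly g l * q1 $ i - (N l *v q2) $ i" for l
    have "poly g l * q0 $ i + l * H l = 0" if "l \<noteq> 0" for l
      using arg_cong[OF N_J[of l q2], of "\<lambda>v. v $ i"]
      unfolding q2[symmetric] N_q1[OF assms that] H_def
      by (simp add: algebra_simps power2_eq_square)
    moreover have "isCont (\<lambda>l. poly g l * q0 $ i + l * H l) 0"
      unfolding H_def by (intro isCont_rules)
    \<comment> \<open>The leading term g(l) q0 varies with l, so the whole left side is taken as the
      continuous function, with constant c = 0.\<close>
    ultimately have "poly g 0 * q0 $ i + 0 * H 0 = 0"
      using vanishing_low_order(2)[of "\<lambda>l. poly g l * q0 $ i + l * H l" 0] by simp
    then show "(poly g 0 *\<^sub>R q0) $ i = 0 $ i" by simp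
  qed
  then show False using poly_g_0 q0_nonzero by simp
qed

text \<open>A multiple of q1 is split off twice: first from v, leaving J w, then from w. Since J q1
  = q0, the second multiple of q1 becomes a multiple of q0.\<close>

lemma decomposition:
  assumes "J *v q1 = q0"
  obtains \<alpha> \<beta> w where "v = \<alpha> *\<^sub>R q0 + \<beta> *\<^sub>R q1 + J *v (J *v w)"
proof -
  note nr = q1_notin_range[OF assms]
  obtain \<beta> w where "v = \<beta> *\<^sub>R q1 + J *v w"
    by (rule complement_of_range[OF nr])
  moreover obtain \<alpha> w' where "w = \<alpha> *\<^sub>R q1 + J *v w'"
    by (rule complement_of_range[OF nr])
  ultimately show ?thesis
    using that[of \<alpha> \<beta> w'] assms
    by (simp add: matrix_vector_right_distrib matrix_vector_mult_scaleR algebra_simps)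
qed

text \<open>The coefficient of q1 vanishes because q1 is outside the range. The rest is J applied to
  a vector of ker J, hence to a multiple of q0 = J q1, and the same argument one level down gives
  the other coefficient.\<close>

lemma decomposition_unique:
  assumes "J *v q1 = q0" and eq: "\<alpha> *\<^sub>R q0 + \<beta> *\<^sub>R q1 + J *v (J *v w) = 0"
  shows "\<alpha> = 0" "\<beta> = 0"
proof -
  note nr = q1_notin_range[OF assms(1)]
  have in_range: "c = 0" if "c *\<^sub>R q1 = J *v x" for c x
    using range_scaleR_cancel[OF that] nr by blast
  have "\<beta> *\<^sub>R q1 = J *v ((- \<alpha>) *\<^sub>R q1 - J *v w)"
    using eq unfolding matrix_vector_mult_diff_distrib matrix_vector_mult_scaleR assms(1)
    by (simp add: algebra_simps eq_neg_iff_add_eq_0)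
  then show "\<beta> = 0" by (rule in_range)
  with eq have "J *v (\<alpha> *\<^sub>R q1 + J *v w) = 0"
    using assms(1) by (simp add: matrix_vector_right_distrib matrix_vector_mult_scaleR)
  then have "\<alpha> *\<^sub>R q1 + J *v w \<in> span {q0}"
    by (simp add: ker_J)
  then obtain k where "\<alpha> *\<^sub>R q1 + J *v w = k *\<^sub>R q0"
    by (auto simp: span_singleton)
  then have "\<alpha> *\<^sub>R q1 = J *v (k *\<^sub>R q1 - w)"
    using assms(1) by (simp add: matrix_vector_mult_diff_distrib matrix_vector_mult_scaleR algebra_simps)
  then show "\<alpha> = 0" by (rule in_range)
qed

lemma frame_exists:
  assumes q1: "J *v q1 = q0"
  obtains p0 p1 where "bt_frame J q0 q1 p0 p1"
proof -
  have "\<exists>\<alpha> \<beta> w. v = \<alpha> *\<^sub>R q0 + \<beta> *\<^sub>R q1 + J *v (J *v w)" for v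
    by (rule decomposition[OF q1]) blast
  then obtain p0 p1 W where dec: "\<And>v. v = p0 v *\<^sub>R q0 + p1 v *\<^sub>R q1 + J *v (J *v W v)"
    by metis
  \<comment> \<open>By uniqueness, any exhibited decomposition determines the values of the chosen
    coordinate functions; linearity and the normalisations follow by exhibiting one.\<close>
  have char: "p0 v = \<alpha> \<and> p1 v = \<beta>" if "v = \<alpha> *\<^sub>R q0 + \<beta> *\<^sub>R q1 + J *v (J *v w)" for v \<alpha> \<beta> w
  proof -
    have "p0 v *\<^sub>R q0 + p1 v *\<^sub>R q1 + J *v (J *v W v) = \<alpha> *\<^sub>R q0 + \<beta> *\<^sub>R q1 + J *v (J *v w)"
      using dec[of v] that by metis
    then have "(p0 v - \<alpha>) *\<^sub>R q0 + (p1 v - \<beta>) *\<^sub>R q1 + J *v (J *v (W v - w)) = 0"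
      by (simp add: matrix_vector_mult_diff_distrib algebra_simps)
    then show ?thesis
      using decomposition_unique[OF q1, of "p0 v - \<alpha>" "p1 v - \<beta>" "W v - w"] by simp
  qed
  have add: "p0 (u + v) = p0 u + p0 v \<and> p1 (u + v) = p1 u + p1 v" for u v
    by (rule char[where w="W u + W v"], subst dec[of u], subst dec[of v])
      (simp add: matrix_vector_right_distrib algebra_simps)
  have scale: "p0 (c *\<^sub>R v) = c * p0 v \<and> p1 (c *\<^sub>R v) = c * p1 v" for c v
    by (rule char[where w="c *\<^sub>R W v"], subst dec[of v])
      (simp add: matrix_vector_mult_scaleR algebra_simps)
  have "p0 q0 = 1 \<and> p1 q0 = 0" by (rule char[where w=0]) simp
  moreover have "p0 q1 = 0 \<and> p1 q1 = 1" by (rule char[where w=0]) simp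
  moreover have "p0 (J *v (J *v w)) = 0 \<and> p1 (J *v (J *v w)) = 0" for w
    by (rule char[where w=w]) simp
  ultimately have "bt_frame J q0 q1 p0 p1"
    using add scale q1 J_q0 by (auto simp: bt_frame_def E_c_def E_tr_def linear_iff)
  then show ?thesis by (rule that)
qed

text \<open>The columns of C are split along the frame, and N(l) is known on each part. The q0 and
  q1 parts have rank one, with traces \<open>p0\<close> (C N(l) q0) and \<open>p1\<close> (C N(l)
  q1); the part in the range of J^2 contributes only from order l^2 on.\<close>

lemma derivative_coefficients:
  assumes frame: "bt_frame J q0 q1 p0 p1"
    and F: "\<And>l. poly f l = trace (N l ** C)"
  shows "coeff f 0 = - p1 (C *v q0) * e_sum (int CARD('n) - 2) J" (is ?low)
    and "coeff f 1 = (p0 (C *v q0) + p1 (C *v q1)) * e_sum (int CARD('n) - 2) J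
      - p1 (C *v q0) * e_sum (int CARD('n) - 3) J" (is ?high)
proof -
  have q1: "J *v q1 = q0" and lin: "linear p0" "linear p1"
    using frame by (auto simp: bt_frame_def)
  have p: "p0 q0 = 1" "p1 q1 = 1" "p0 q1 = 0" "p1 q0 = 0"
    "p0 (J *v (J *v w)) = 0" "p1 (J *v (J *v w)) = 0" for w
    using frame by (auto simp: bt_frame_def E_tr_def)
  have "\<exists>w. C *v axis i 1 = p0 (C *v axis i 1) *\<^sub>R q0 + p1 (C *v axis i 1) *\<^sub>R q1 + J *v (J *v w)" for i
  proof -
    obtain \<alpha> \<beta> w where v: "C *v axis i 1 = \<alpha> *\<^sub>R q0 + \<beta> *\<^sub>R q1 + J *v (J *v w)"
      by (rule decomposition[OF q1])
    then have "p0 (C *v axis i 1) = \<alpha>" "p1 (C *v axis i 1) = \<beta>"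
      using lin p by (simp_all add: linear_add linear_scale)
    with v show ?thesis by metis
  qed
  then obtain w where w: "\<And>i. C *v axis i 1 = p0 (C *v axis i 1) *\<^sub>R q0 + p1 (C *v axis i 1) *\<^sub>R q1
      + J *v (J *v w i)" by metis
  have lC: "linear (\<lambda>v. p0 (C *v v))" "linear (\<lambda>v. p1 (C *v v))"
    using lin by (auto simp: linear_iff matrix_vector_right_distrib matrix_vector_mult_scaleR)
  define H where "H l = (\<Sum>i\<in>UNIV. poly g l * ((J *v w i) $ i - l * w i $ i) + (N l *v w i) $ i)" for l
  have NJJ: "N l *v (J *v (J *v x)) = l\<^sup>2 *\<^sub>R (poly g l *\<^sub>R (J *v x - l *\<^sub>R x) + N l *v x)" for l x
    unfolding N_J by (simp add: algebra_simps power2_eq_square)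
  have eq: "poly f l = l * poly g l * (p0 (C *v q0) + p1 (C *v q1)) - poly g l * p1 (C *v q0) + l\<^sup>2 * H l"
    if l: "l \<noteq> 0" for l
  proof -
    have "poly f l = (\<Sum>i\<in>UNIV. p0 (C *v axis i 1) * (N l *v q0) $ i + p1 (C *v axis i 1) * (N l *v q1) $ i
        + (N l *v (J *v (J *v w i))) $ i)"
      unfolding F trace_eq_sum_axis
      by (subst w) (simp add: matrix_vector_right_distrib matrix_vector_mult_scaleR)
    also have "\<dots> = p0 (C *v (N l *v q0)) + p1 (C *v (N l *v q1)) + l\<^sup>2 * H l"
      using sum_axis_linear[OF lC(1)] sum_axis_linear[OF lC(2)]
      by (simp only: sum.distrib NJJ) (simp add: H_def sum_distrib_left)
    finally show ?thesis
      using lin by (simp add: matrix_vector_mult_scaleR matrix_vector_mult_diff_distrib N_q0 N_q1 q1 l linear_diff linear_scale algebra_simps)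
  qed
  obtain f0 f1 f2 where f: "f = pCons f0 (pCons f1 f2)"
    by (metis pCons_cases)
  obtain g0 g1 g2 where g: "g = pCons g0 (pCons g1 g2)"
    by (metis pCons_cases)
  have g01: "g0 = e_sum (int CARD('n) - 2) J" "g1 = e_sum (int CARD('n) - 3) J"
    using coeff_g[of 0] coeff_g[of 1] by (simp_all add: g)
  define A where "A = p0 (C *v q0) + p1 (C *v q1)"
  define B where "B = p1 (C *v q0)"
  \<comment> \<open>M is what remains of the identity after the constant term is removed and l
    divided out. M(0) is therefore the defect in the formula for the coefficient of l.\<close>
  define M where "M l = f1 - (g0 * A - g1 * B) + l * (poly f2 l - poly (pCons g1 g2) l * A + poly g2 l * B - H l)" for l
  have cont: "isCont M 0"
    unfolding M_def H_def by (intro isCont_rules)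
  have zero: "(f0 + g0 * B) + l * M l = 0" if "l \<noteq> 0" for l
    using eq[OF that] unfolding M_def f g A_def[symmetric] B_def[symmetric] by (simp add: algebra_simps power2_eq_square)
  from vanishing_low_order[OF cont zero] show ?low ?high
    by (simp_all add: f M_def A_def B_def g01 algebra_simps)
qed

end

section \<open>Derivatives of the coefficients along the kernel\<close>

lemma has_derivative_frechet_derivative:
  "f differentiable (at x) \<Longrightarrow> (f has_derivative frechet_derivative f (at x)) (at x)"
  by (simp add: frechet_derivative_works)

lemma Ck_on_2_differentiable:
  assumes "Ck_on 2 X U" "x \<in> U"
  shows "X differentiable (at x)" "(\<lambda>z. frechet_derivative X (at z) v) differentiable (at x)"
  using assms by (auto simp: numeral_2_eq_2)

text \<open>Linearity in the inner direction is not built into the outer derivative. It holds for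
  \<open>frechet_derivative X (at z)\<close> at each z in U, and these identities on an open set are
  then differentiated at p.\<close>

lemma linear_second_derivative:
  assumes "open U" "Ck_on 2 X U" "p \<in> U"
  shows "linear (second_derivative X p u)"
proof (rule linearI)
  note d = Ck_on_2_differentiable[OF assms(2)]
  note hd = has_derivative_frechet_derivative[OF d(2)[OF assms(3)]]
  have lin: "linear (frechet_derivative X (at z))" if "z \<in> U" for z
    using d(1)[OF that] by (rule linear_frechet_derivative)
  fix v w c
  have "((\<lambda>z. frechet_derivative X (at z) (v + w)) has_derivative
      (\<lambda>u. second_derivative X p u v + second_derivative X p u w)) (at p)"
    unfolding second_derivative_def
    by (rule has_derivative_transform_within_open[OF has_derivative_add[OF hd hd] assms(1,3)])
      (simp add: linear_add[OF lin])
  from fun_cong[OF frechet_derivative_at[OF this], of u]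
  show "second_derivative X p u (v + w) = second_derivative X p u v + second_derivative X p u w"
    unfolding second_derivative_def[of X p u "v + w"] by (rule sym)
  have "((\<lambda>z. frechet_derivative X (at z) (c *\<^sub>R v)) has_derivative
      (\<lambda>u. c *\<^sub>R second_derivative X p u v)) (at p)"
    unfolding second_derivative_def
    by (rule has_derivative_transform_within_open[OF has_derivative_scaleR_right[OF hd] assms(1,3)])
      (simp add: linear_scale[OF lin])
  from fun_cong[OF frechet_derivative_at[OF this], of u]
  show "second_derivative X p u (c *\<^sub>R v) = c *\<^sub>R second_derivative X p u v"
    unfolding second_derivative_def[of X p u "c *\<^sub>R v"] by (rule sym)
qed

lemma has_real_derivative_jacobian_line:
  fixes X :: "real^'n \<Rightarrow> real^'n"
  assumes "open U" "Ck_on 2 X U" "p \<in> U"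
  shows "((\<lambda>s. jacobian X (at (p + s *\<^sub>R u)) $ i $ j) has_real_derivative
    matrix (second_derivative X p u) $ i $ j) (at 0)"
proof -
  let ?D = "\<lambda>z. frechet_derivative X (at z) (axis j 1)"
  have line: "((\<lambda>s::real. p + s *\<^sub>R u) has_derivative (\<lambda>s. s *\<^sub>R u)) (at 0)"
    by (auto intro!: derivative_eq_intros)
  have "(?D has_derivative frechet_derivative ?D (at p)) (at (p + 0 *\<^sub>R u))"
    using has_derivative_frechet_derivative[OF Ck_on_2_differentiable(2)[OF assms(2,3)]] by simp
  then have "((\<lambda>s. ?D (p + s *\<^sub>R u)) has_derivative (\<lambda>s. frechet_derivative ?D (at p) (s *\<^sub>R u))) (at 0)"
    by (rule has_derivative_compose[OF line])
  then have "((\<lambda>s. ?D (p + s *\<^sub>R u) $ i) has_derivative (\<lambda>s. frechet_derivative ?D (at p) (s *\<^sub>R u) $ i)) (at 0)"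
    by (rule bounded_linear.has_derivative[OF bounded_linear_vec_nth])
  moreover have "linear (frechet_derivative ?D (at p))"
    using Ck_on_2_differentiable(2)[OF assms(2,3)] by (rule linear_frechet_derivative)
  ultimately show ?thesis
    by (simp add: has_field_derivative_def linear_scale jacobian_def matrix_def
        second_derivative_def mult.commute[of _ "_ $ _"])
qed

text \<open>Needed because \<open>deriv\<close> carries information only where the function is
  differentiable; \<open>e_sum\<close> is a polynomial in the entries.\<close>

lemma e_sum_differentiable:
  fixes A :: "real \<Rightarrow> real^'n^'n"
  assumes "\<And>i j. (\<lambda>s. A s $ i $ j) field_differentiable (at t)"
  shows "(\<lambda>s. e_sum k (A s)) field_differentiable (at t)"
proof -
  have prod: "(\<lambda>s. \<Prod>i\<in>S. A s $ i $ \<sigma> i) field_differentiable (at t)" for S \<sigma>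
  proof -
    obtain A' where A': "\<And>i j. ((\<lambda>s. A s $ i $ j) has_field_derivative A' i j) (at t)"
      using assms unfolding field_differentiable_def by metis
    then show ?thesis
      unfolding field_differentiable_def
      using has_field_derivative_prod[of S "\<lambda>i s. A s $ i $ \<sigma> i", OF A'] by blast
  qed
  show ?thesis
    unfolding e_sum_def principal_minor_def
    by (cases "k < 0") (auto intro!: derivative_intros field_differentiable_sum prod)
qed

section \<open>Derivative formulas for a vector field and independence of the frame\<close>

locale bt_field = bogdanov_takens J q0 for J :: "real^'n^'n" and q0 +
  fixes X :: "real^'n \<Rightarrow> real^'n" and U p
  assumes open_U: "open U" and C2: "Ck_on 2 X U" and p_in_U: "p \<in> U"
    and J_eq: "J = jacobian X (at p)"
begin

definition De :: "int \<Rightarrow> real" where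
  "De k = deriv (\<lambda>s::real. e_sum k (jacobian X (at (p + s *\<^sub>R q0)))) 0"

lemma e_sum_line_differentiable:
  "(\<lambda>s::real. e_sum k (jacobian X (at (p + s *\<^sub>R q0)))) field_differentiable (at 0)"
  using has_real_derivative_jacobian_line[OF open_U C2 p_in_U]
  by (intro e_sum_differentiable) (auto simp: field_differentiable_def)

text \<open>The same s-derivative is computed twice: coefficientwise it is \<open>poly f l\<close>,
  by Jacobi's formula a trace. \<open>DERIV_unique\<close> identifies the two for every l, which is
  the hypothesis of \<open>derivative_coefficients\<close> with C the map B(q0, .).\<close>

lemma derivative_formulas:
  assumes "bt_frame J q0 q1 p0 p1"
  shows "De (int CARD('n)) = - p1 (second_derivative X p q0 q0) * e_sum (int CARD('n) - 2) J" (is ?low)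
    and "De (int CARD('n) - 1) =
      (p0 (second_derivative X p q0 q0) + p1 (second_derivative X p q0 q1)) * e_sum (int CARD('n) - 2) J
      - p1 (second_derivative X p q0 q0) * e_sum (int CARD('n) - 3) J" (is ?high)
proof -
  let ?n = "CARD('n)"
  define A where "A s = jacobian X (at (p + s *\<^sub>R q0))" for s :: real
  define C where "C = matrix (second_derivative X p q0)"
  define f where "f = (\<Sum>i\<le>?n. monom (De (int ?n - int i)) i)"
  have A0: "A 0 = J" by (simp add: A_def J_eq)
  have C: "C *v v = second_derivative X p q0 v" for v
    unfolding C_def using linear_second_derivative[OF open_U C2 p_in_U] by (metis matrix_vector_mul(2))
  have DA: "((\<lambda>s. A s $ i $ j) has_real_derivative C $ i $ j) (at 0)" for i j
    unfolding A_def C_def by (rule has_real_derivative_jacobian_line[OF open_U C2 p_in_U])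
  have De: "((\<lambda>s. e_sum k (A s)) has_real_derivative De k) (at 0)" for k
    unfolding De_def A_def using e_sum_line_differentiable DERIV_deriv_iff_field_differentiable by blast
  have F: "poly f l = trace (N l ** C)" for l
  proof (rule DERIV_unique)
    have "((\<lambda>s. det (mat l + A s)) has_real_derivative trace (adjugate (mat l + A 0) ** C)) (at 0)"
      by (rule has_real_derivative_det) (auto intro!: derivative_eq_intros DA)
    then show "((\<lambda>s. det (mat l + A s)) has_real_derivative trace (N l ** C)) (at 0)"
      by (simp only: N_def A0)
    have "det (mat l + A s) = (\<Sum>i\<le>?n. e_sum (int ?n - int i) (A s) * l ^ i)" for s
      by (simp add: poly_minor_poly[symmetric] minor_poly_def poly_sum poly_monom)
    then show "((\<lambda>s. det (mat l + A s)) has_real_derivative poly f l) (at 0)"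
      by (auto simp: f_def poly_sum poly_monom intro!: derivative_eq_intros De)
  qed
  \<comment> \<open>Keeps index 1 inside the range of the sum that defines f.\<close>
  have "1 \<le> ?n" by (simp add: Suc_leI)
  then have "coeff f 0 = De (int ?n)" "coeff f 1 = De (int ?n - 1)"
    by (simp_all add: f_def coeff_sum)
  then show ?low ?high
    using derivative_coefficients[OF assms F] by (simp_all add: C)
qed

lemma q1_exists: obtains q1 where "J *v q1 = q0"
  using q0_in_range by (auto simp: eq_commute)

lemma bt_coeffs_eq:
  assumes "bt_frame J q0 q1 p0 p1"
  shows "bt_coeffs X p q0 = (1/2 * p1 (second_derivative X p q0 q0),
    p0 (second_derivative X p q0 q0) + p1 (second_derivative X p q0 q1))"
  unfolding bt_coeffs_def J_eq[symmetric]
proof (rule the_equality)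
  fix ab assume "\<exists>q1 p0 p1. bt_frame J q0 q1 p0 p1 \<and> ab = (1/2 * p1 (second_derivative X p q0 q0),
    p0 (second_derivative X p q0 q0) + p1 (second_derivative X p q0 q1))"
  then obtain q1' p0' p1' where fr: "bt_frame J q0 q1' p0' p1'"
    and ab: "ab = (1/2 * p1' (second_derivative X p q0 q0),
    p0' (second_derivative X p q0 q0) + p1' (second_derivative X p q0 q1'))" by blast
  have "p1 (second_derivative X p q0 q0) = p1' (second_derivative X p q0 q0)"
    using derivative_formulas(1)[OF fr] derivative_formulas(1)[OF assms] e_n2 by simp
  then show "ab = (1/2 * p1 (second_derivative X p q0 q0),
    p0 (second_derivative X p q0 q0) + p1 (second_derivative X p q0 q1))"
    using derivative_formulas(2)[OF fr] derivative_formulas(2)[OF assms] e_n2 by (simp add: ab)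
qed (use assms in blast)

end

section \<open>Calculus of iterated directional derivatives\<close>

lemma Ck_on_Suc_imp: "Ck_on (Suc k) f S \<Longrightarrow> Ck_on k f S"
proof (induction k arbitrary: f)
  case 0
  then show ?case
    by (simp add: continuous_at_imp_continuous_on differentiable_imp_continuous_within)
next
  case (Suc k)
  then show ?case by simp
qed

lemma Ck_on_mono:
  assumes "Ck_on m f S" "k \<le> m"
  shows "Ck_on k f S"
  using assms(2)
proof (induction rule: inc_induct)
  case base
  show ?case by (rule assms(1))
next
  case (step j)
  then show ?case by (intro Ck_on_Suc_imp[of j])
qed

lemma Ck_on_imp_continuous_on: "Ck_on k f S \<Longrightarrow> continuous_on S f"
  using Ck_on_mono[of k f S 0] by simp

lemma Ck_on_subset: "Ck_on k f S \<Longrightarrow> T \<subseteq> S \<Longrightarrow> Ck_on k f T"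
  by (induction k arbitrary: f) (auto intro: continuous_on_subset)

lemma Ck_on_has_derivative:
  assumes "Ck_on k f S" "0 < k" "x \<in> S"
  shows "(f has_derivative frechet_derivative f (at x)) (at x)"
  using Ck_on_mono[OF assms(1), of "Suc 0"] assms(2,3) by (simp add: frechet_derivative_works)

lemma Ck_on_frechet_derivative:
  "Ck_on (Suc k) f S \<Longrightarrow> Ck_on k (\<lambda>x. frechet_derivative f (at x) v) S"
  by simp

lemma Ck_on_cong:
  assumes "open S" "\<And>x. x \<in> S \<Longrightarrow> f x = g x" "Ck_on k f S"
  shows "Ck_on k g S"
  using assms(2,3)
proof (induction k arbitrary: f g)
  case 0
  then show ?case
    unfolding Ck_on.simps by (blast intro: continuous_on_eq)
next
  case (Suc k)
  have g: "(g has_derivative frechet_derivative f (at x)) (at x)" if "x \<in> S" for x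
    by (rule has_derivative_transform_within_open[OF
          Ck_on_has_derivative[OF Suc.prems(2) _ that] assms(1) that Suc.prems(1)]) simp_all
  have "frechet_derivative f (at x) v = frechet_derivative g (at x) v" if "x \<in> S" for x v
    using frechet_derivative_at[OF g[OF that]] by simp
  moreover have "Ck_on k (\<lambda>x. frechet_derivative f (at x) v) S" for v
    using Suc.prems(2) by simp
  ultimately have "Ck_on k (\<lambda>x. frechet_derivative g (at x) v) S" for v
    by (rule Suc.IH)
  moreover have "g differentiable (at x)" if "x \<in> S" for x
    using g[OF that] by (rule differentiableI)
  ultimately show ?case by simp
qed

text \<open>Any derivative found by the calculus rules may be used here; uniqueness of derivatives
  and \<open>Ck_on_cong\<close> pass to \<open>frechet_derivative\<close>.\<close>

lemma Ck_on_SucI: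
  assumes "open S" "\<And>x. x \<in> S \<Longrightarrow> (f has_derivative f' x) (at x)"
    and "\<And>v. Ck_on k (\<lambda>x. f' x v) S"
  shows "Ck_on (Suc k) f S"
proof -
  have "Ck_on k (\<lambda>x. frechet_derivative f (at x) v) S" for v
    using frechet_derivative_at[OF assms(2)] by (intro Ck_on_cong[OF assms(1) _ assms(3)[of v]]) metis
  moreover have "f differentiable (at x)" if "x \<in> S" for x
    using assms(2)[OF that] by (rule differentiableI)
  ultimately show ?thesis by simp
qed

lemma Ck_on_const: "Ck_on k (\<lambda>x. c) S"
  by (induction k arbitrary: c) auto

lemma Ck_on_bounded_linear:
  assumes "bounded_linear f" "open S"
  shows "Ck_on k f S"
proof (cases k)
  case 0
  then show ?thesis using assms by (simp add: linear_continuous_on)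
next
  case (Suc m)
  show ?thesis
    unfolding Suc
    by (rule Ck_on_SucI[OF assms(2) bounded_linear_imp_has_derivative[OF assms(1)] Ck_on_const])
qed

lemma Ck_on_add:
  assumes "open S" "Ck_on k f S" "Ck_on k g S"
  shows "Ck_on k (\<lambda>x. f x + g x) S"
  using assms(2,3)
proof (induction k arbitrary: f g)
  case 0
  then show ?case by (simp add: continuous_on_add)
next
  case (Suc k)
  show ?case
    by (rule Ck_on_SucI[OF assms(1) has_derivative_add[OF
          Ck_on_has_derivative[OF Suc.prems(1)] Ck_on_has_derivative[OF Suc.prems(2)]]])
      (use Suc in auto)
qed

lemma Ck_on_sum:
  assumes "open S" "\<And>i. i \<in> I \<Longrightarrow> Ck_on k (f i) S"
  shows "Ck_on k (\<lambda>x. \<Sum>i\<in>I. f i x) S"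
  using assms(2)
proof (induction I rule: infinite_finite_induct)
  case (insert i I)
  then have "Ck_on k (\<lambda>x. f i x + (\<Sum>i\<in>I. f i x)) S"
    by (intro Ck_on_add[OF assms(1)]) auto
  with insert.hyps show ?case by simp
qed (simp_all add: Ck_on_const)

lemma Ck_on_bilinear:
  assumes "bounded_bilinear P" "open S" "Ck_on k f S" "Ck_on k g S"
  shows "Ck_on k (\<lambda>x. P (f x) (g x)) S"
  using assms(3,4)
proof (induction k arbitrary: f g)
  case 0
  then show ?case by (simp add: bounded_bilinear.continuous_on[OF assms(1)])
next
  case (Suc k)
  show ?case
  proof (rule Ck_on_SucI[OF assms(2)])
    show "((\<lambda>x. P (f x) (g x)) has_derivative (\<lambda>v. P (f x) (frechet_derivative g (at x) v)
        + P (frechet_derivative f (at x) v) (g x))) (at x)" if "x \<in> S" for x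
      using that Suc.prems
      by (intro bounded_bilinear.FDERIV[OF assms(1)] Ck_on_has_derivative) auto
    show "Ck_on k (\<lambda>x. P (f x) (frechet_derivative g (at x) v)
        + P (frechet_derivative f (at x) v) (g x)) S" for v
      by (intro Ck_on_add assms(2) Suc.IH Suc.prems[THEN Ck_on_Suc_imp])
        (use Suc.prems in simp_all)
  qed
qed

lemma Ck_on_linear_compose:
  assumes "bounded_linear L" "open S" "Ck_on k f S"
  shows "Ck_on k (\<lambda>x. L (f x)) S"
  using assms(3)
proof (induction k arbitrary: f)
  case 0
  then show ?case by (simp add: bounded_linear.continuous_on[OF assms(1)])
next
  case (Suc k)
  show ?case
    by (rule Ck_on_SucI[OF assms(2) bounded_linear.has_derivative[OF assms(1)
            Ck_on_has_derivative[OF Suc.prems]]])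
      (use Suc in auto)
qed

lemma Ck_on_Pair:
  assumes "open S" "Ck_on k f S" "Ck_on k g S"
  shows "Ck_on k (\<lambda>x. (f x, g x)) S"
proof -
  have "Ck_on k (\<lambda>x. (f x, 0) + (0, g x)) S"
    using assms
    by (intro Ck_on_add Ck_on_linear_compose[where L="\<lambda>x. (x, 0)"] Ck_on_linear_compose[where L="\<lambda>x. (0, x)"]
       bounded_linear_Pair bounded_linear_ident bounded_linear_zero)
  then show ?thesis by simp
qed

text \<open>In the chain rule the direction fed to the derivative of f varies with x, whereas
  \<open>Ck_on\<close> controls fixed directions only. Expanding that direction in the basis gives a
  finite sum of products to which the induction hypothesis applies.\<close>

lemma Ck_on_compose:
  fixes f :: "'b::euclidean_space \<Rightarrow> 'c::real_normed_vector" and g :: "'a::euclidean_space \<Rightarrow> 'b"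
  assumes "open S" "open T" "g ` S \<subseteq> T" "Ck_on k f T" "Ck_on k g S"
  shows "Ck_on k (\<lambda>x. f (g x)) S"
  using assms(4,5)
proof (induction k arbitrary: f)
  case 0
  then show ?case
    using continuous_on_compose2[OF _ _ assms(3), of f] by simp
next
  case (Suc k)
  have lin: "linear (frechet_derivative f (at y))" if "y \<in> T" for y
    using Ck_on_has_derivative[OF Suc.prems(1) _ that] has_derivative_linear by blast
  show ?case
  proof (rule Ck_on_SucI[OF assms(1)])
    show "((\<lambda>x. f (g x)) has_derivative (\<lambda>v. frechet_derivative f (at (g x)) (frechet_derivative g (at x) v))) (at x)"
      if "x \<in> S" for x
      using that assms(3) by (intro has_derivative_compose[OF Ck_on_has_derivative[OF Suc.prems(2)]]
          Ck_on_has_derivative[OF Suc.prems(1)]) auto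
    fix v
    show "Ck_on k (\<lambda>x. frechet_derivative f (at (g x)) (frechet_derivative g (at x) v)) S"
    proof (rule Ck_on_cong[OF assms(1)])
      fix x assume that: "x \<in> S"
      show "(\<Sum>b\<in>Basis. (frechet_derivative g (at x) v \<bullet> b) *\<^sub>R frechet_derivative f (at (g x)) b)
          = frechet_derivative f (at (g x)) (frechet_derivative g (at x) v)"
      proof -
        have "linear (frechet_derivative f (at (g x)))" using lin assms(3) that by blast
        from linear_sum[OF this, of "\<lambda>b. (frechet_derivative g (at x) v \<bullet> b) *\<^sub>R b" Basis] linear_scale[OF this]
        show ?thesis by (simp add: euclidean_representation)
      qed
    next
      show "Ck_on k (\<lambda>x. \<Sum>b\<in>Basis. (frechet_derivative g (at x) v \<bullet> b) *\<^sub>R frechet_derivative f (at (g x)) b) S"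
      proof (intro Ck_on_sum assms(1) Ck_on_bilinear[OF bounded_bilinear_scaleR])
        show "Ck_on k (\<lambda>x. frechet_derivative g (at x) v \<bullet> b) S" for b
          using Suc.prems(2) by (intro Ck_on_linear_compose[OF bounded_linear_inner_left assms(1)]) auto
        show "Ck_on k (\<lambda>x. frechet_derivative f (at (g x)) b) S" for b
          by (intro Suc.IH Suc.prems(2)[THEN Ck_on_Suc_imp]) (use Suc.prems in simp)
      qed
    qed
  qed
qed

text \<open>The direction comes first so that \<open>dir_deriv v ^^ k\<close> is the k-th derivative
  along v. Taylor sums are written with these powers, and no multilinear higher derivative is
  formed.\<close>

definition dir_deriv :: "'a::euclidean_space \<Rightarrow> ('a \<Rightarrow> real) \<Rightarrow> 'a \<Rightarrow> real" where
  "dir_deriv v f x = frechet_derivative f (at x) v"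

lemma Ck_on_dir_deriv: "Ck_on (Suc k) f S \<Longrightarrow> Ck_on k (dir_deriv v f) S"
  by (simp add: dir_deriv_def[abs_def])

lemma Ck_on_dir_deriv_funpow: "Ck_on (m + k) f S \<Longrightarrow> Ck_on m ((dir_deriv v ^^ k) f) S"
proof (induction k arbitrary: f)
  case (Suc k)
  have "Ck_on (m + k) (dir_deriv v f) S"
    using Suc.prems unfolding add_Suc_right by (rule Ck_on_dir_deriv)
  from Suc.IH[OF this] show ?case
    by (simp only: funpow_Suc_right o_apply)
qed simp

lemma dir_deriv_lincomb:
  assumes "open S" "finite B" "\<And>b. b \<in> B \<Longrightarrow> Ck_on (Suc 0) (F b) S" "x \<in> S"
    and "\<And>x. x \<in> S \<Longrightarrow> f x = (\<Sum>b\<in>B. c b * F b x)"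
  shows "dir_deriv w f x = (\<Sum>b\<in>B. c b * dir_deriv w (F b) x)"
proof -
  have "((\<lambda>x. \<Sum>b\<in>B. c b * F b x) has_derivative (\<lambda>w. \<Sum>b\<in>B. c b * frechet_derivative (F b) (at x) w)) (at x)"
    by (intro has_derivative_sum has_derivative_mult_right Ck_on_has_derivative[OF assms(3)] assms(4)) simp_all
  then have "(f has_derivative (\<lambda>w. \<Sum>b\<in>B. c b * frechet_derivative (F b) (at x) w)) (at x)"
    by (rule has_derivative_transform_within_open[OF _ assms(1,4) assms(5)[symmetric]])
  from fun_cong[OF frechet_derivative_at[OF this], of w] show ?thesis
    by (simp only: dir_deriv_def)
qed

text \<open>The coefficients are constants and so pass through all k derivatives. With
  \<open>c b\<close> = w \<bullet> b this expands the innermost direction while the outer ones stay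
  w.\<close>

lemma dir_deriv_funpow_lincomb:
  assumes "open S" "finite B" "\<And>b. b \<in> B \<Longrightarrow> Ck_on k (F b) S"
    and "\<And>x. x \<in> S \<Longrightarrow> f x = (\<Sum>b\<in>B. c b * F b x)" and "x \<in> S"
  shows "(dir_deriv w ^^ k) f x = (\<Sum>b\<in>B. c b * (dir_deriv w ^^ k) (F b) x)"
  using assms(3,4,5)
proof (induction k arbitrary: f F x)
  case (Suc k)
  have "dir_deriv w f x = (\<Sum>b\<in>B. c b * dir_deriv w (F b) x)" if "x \<in> S" for x
    by (rule dir_deriv_lincomb[OF assms(1,2) Ck_on_mono[OF Suc.prems(1)] that Suc.prems(2)]) simp_all
  then have "(dir_deriv w ^^ k) (dir_deriv w f) x = (\<Sum>b\<in>B. c b * (dir_deriv w ^^ k) (dir_deriv w (F b)) x)"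
    by (intro Suc.IH Ck_on_dir_deriv Suc.prems)
  then show ?case by (simp only: funpow_Suc_right o_apply)
qed (simp only: funpow.simps id_apply)

lemma dir_deriv_linear:
  assumes "Ck_on k f S" "0 < k" "x \<in> S"
  shows "linear (\<lambda>v. dir_deriv v f x)"
  unfolding dir_deriv_def using Ck_on_has_derivative[OF assms] by (rule has_derivative_linear)

lemma dir_deriv_funpow_scale:
  assumes "open S" "Ck_on k f S" "x \<in> S"
  shows "(dir_deriv (c *\<^sub>R w) ^^ k) f x = c ^ k * (dir_deriv w ^^ k) f x"
  using assms(2,3)
proof (induction k arbitrary: f x)
  case (Suc k)
  \<comment> \<open>A sum over one element, so that the rule for linear combinations also covers
    scaling.\<close>
  have "(dir_deriv (c *\<^sub>R w) ^^ k) (dir_deriv (c *\<^sub>R w) f) x = (\<Sum>b\<in>{()}. c * (dir_deriv (c *\<^sub>R w) ^^ k) (dir_deriv w f) x)"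
    using Suc.prems linear_scale[OF dir_deriv_linear[OF Suc.prems(1)]]
    by (intro dir_deriv_funpow_lincomb[OF assms(1)] Ck_on_dir_deriv) auto
  also have "\<dots> = c ^ Suc k * (dir_deriv w ^^ k) (dir_deriv w f) x"
    using Suc.IH[OF Ck_on_dir_deriv[OF Suc.prems(1)] Suc.prems(2), of w] by simp
  finally show ?case by (simp only: funpow_Suc_right o_apply)
qed simp

text \<open>Uniformity in w comes from expanding one direction in the basis at each step: constants
  are needed for the finitely many basis directions only, and every expansion contributes a factor
  |w|.\<close>

lemma dir_deriv_funpow_bound:
  fixes f :: "'a::euclidean_space \<Rightarrow> real"
  assumes "open S" "compact K" "K \<subseteq> S" "Ck_on k f S"
  shows "\<exists>M\<ge>0. \<forall>x\<in>K. \<forall>w. \<bar>(dir_deriv w ^^ k) f x\<bar> \<le> M * norm w ^ k"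
  using assms(4)
proof (induction k arbitrary: f)
  case 0
  then have "compact (f ` K)"
    using assms by (auto intro: compact_continuous_image continuous_on_subset)
  then obtain M where "\<forall>x\<in>K. \<bar>f x\<bar> \<le> M"
    using compact_imp_bounded bounded_iff by (metis imageI real_norm_def)
  then show ?case by (intro exI[of _ "max M 0"]) (auto simp: le_max_iff_disj)
next
  case (Suc k)
  have "\<exists>M\<ge>0. \<forall>x\<in>K. \<forall>w. \<bar>(dir_deriv w ^^ k) (dir_deriv b f) x\<bar> \<le> M * norm w ^ k" for b
    by (rule Suc.IH[OF Ck_on_dir_deriv[OF Suc.prems]])
  then obtain M where M: "\<And>b. M b \<ge> 0" "\<And>b x w. x \<in> K \<Longrightarrow> \<bar>(dir_deriv w ^^ k) (dir_deriv b f) x\<bar> \<le> M b * norm w ^ k"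
    by metis
  have "\<bar>(dir_deriv w ^^ Suc k) f x\<bar> \<le> (\<Sum>b\<in>Basis. M b) * norm w ^ Suc k" if "x \<in> K" for x w
  proof -
    have "dir_deriv w f y = (\<Sum>b\<in>Basis. (w \<bullet> b) * dir_deriv b f y)" if "y \<in> S" for y
    proof -
      have "linear (\<lambda>v. dir_deriv v f y)" by (rule dir_deriv_linear[OF Suc.prems _ that]) simp
      from linear_sum[OF this, of "\<lambda>b. (w \<bullet> b) *\<^sub>R b" Basis] linear_scale[OF this] show ?thesis
        by (simp add: euclidean_representation)
    qed
    then have "(dir_deriv w ^^ k) (dir_deriv w f) x = (\<Sum>b\<in>Basis. (w \<bullet> b) * (dir_deriv w ^^ k) (dir_deriv b f) x)"
      using Suc.prems assms(3) \<open>x \<in> K\<close> by (intro dir_deriv_funpow_lincomb[OF assms(1)] Ck_on_dir_deriv) auto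
    also have "\<bar>\<dots>\<bar> \<le> (\<Sum>b\<in>Basis. norm w * (M b * norm w ^ k))"
      by (rule order.trans[OF sum_abs], rule sum_mono)
        (auto simp: abs_mult intro!: mult_mono Basis_le_norm M \<open>x \<in> K\<close>)
    finally show ?thesis
      by (simp only: funpow_Suc_right o_apply) (simp add: sum_distrib_left sum_distrib_right algebra_simps)
  qed
  then show ?case by (intro exI[of _ "\<Sum>b\<in>Basis. M b"]) (auto intro: sum_nonneg M)
qed

lemma has_real_derivative_line:
  assumes "Ck_on k f S" "0 < k" "x + t *\<^sub>R w \<in> S"
  shows "((\<lambda>t. f (x + t *\<^sub>R w)) has_real_derivative dir_deriv w f (x + t *\<^sub>R w)) (at t)"
proof -
  have "((\<lambda>t. x + t *\<^sub>R w) has_derivative (\<lambda>s. s *\<^sub>R w)) (at t)"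
    by (auto intro!: derivative_eq_intros)
  from has_derivative_compose[OF this Ck_on_has_derivative[OF assms]]
  have "((\<lambda>t. f (x + t *\<^sub>R w)) has_derivative (\<lambda>s. dir_deriv (s *\<^sub>R w) f (x + t *\<^sub>R w))) (at t)"
    by (simp only: dir_deriv_def)
  then show ?thesis
    using linear_scale[OF dir_deriv_linear[OF assms]]
    by (simp add: has_field_derivative_def mult_commute_abs)
qed

lemma Taylor_line:
  fixes f :: "'a::euclidean_space \<Rightarrow> real"
  assumes "Ck_on k f S" "0 < k" "\<And>t. 0 \<le> t \<Longrightarrow> t \<le> 1 \<Longrightarrow> p + t *\<^sub>R w \<in> S"
  obtains t where "0 < t" "t < 1"
    "f (p + w) = (\<Sum>j<k. (dir_deriv w ^^ j) f p / fact j) + (dir_deriv w ^^ k) f (p + t *\<^sub>R w) / fact k"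
proof -
  define df where "df j t = (dir_deriv w ^^ j) f (p + t *\<^sub>R w)" for j and t :: real
  have "(df j has_real_derivative df (Suc j) t) (at t)" if "j < k" "0 \<le> t" "t \<le> 1" for j t
  proof -
    have C: "Ck_on (k - j) ((dir_deriv w ^^ j) f) S"
      using that assms(1) by (intro Ck_on_dir_deriv_funpow) simp
    from has_real_derivative_line[OF C, of p t w] show ?thesis
      using that assms(3) by (simp add: df_def[abs_def])
  qed
  then have "\<exists>t>0. t < 1 \<and> df 0 1 = (\<Sum>j<k. (df j 0 / fact j) * (1 - 0)^j) + (df k t / fact k) * (1 - 0)^k"
    using assms(2) by (intro Taylor_up[where a=0]) auto
  then show ?thesis
    using that by (auto simp: df_def)
qed

lemma Taylor_bound:
  fixes f :: "'a::euclidean_space \<Rightarrow> real"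
  assumes "open S" "Ck_on k f S" "0 < k" "p \<in> S"
  obtains M r where "M \<ge> 0" "r > 0"
    "\<forall>w. norm w \<le> r \<longrightarrow> \<bar>f (p + w) - (\<Sum>j<k. (dir_deriv w ^^ j) f p / fact j)\<bar> \<le> M * norm w ^ k"
proof -
  obtain r where r: "r > 0" "cball p r \<subseteq> S"
    using assms by (meson open_contains_cball)
  obtain M where M: "M \<ge> 0" "\<And>x w. x \<in> cball p r \<Longrightarrow> \<bar>(dir_deriv w ^^ k) f x\<bar> \<le> M * norm w ^ k"
    using dir_deriv_funpow_bound[OF assms(1) compact_cball r(2) assms(2)] by blast
  have "\<bar>f (p + w) - (\<Sum>j<k. (dir_deriv w ^^ j) f p / fact j)\<bar> \<le> M * norm w ^ k" if w: "norm w \<le> r" for w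
  proof -
    have in_ball: "p + t *\<^sub>R w \<in> cball p r" if "0 \<le> t" "t \<le> 1" for t
    proof -
      have "t * norm w \<le> 1 * r"
        using that w by (intro mult_mono) auto
      with that show ?thesis by (simp add: dist_norm)
    qed
    then have seg: "p + t *\<^sub>R w \<in> S" if "0 \<le> t" "t \<le> 1" for t
      using that r(2) by blast
    obtain t where t: "0 < t" "t < 1"
      "f (p + w) = (\<Sum>j<k. (dir_deriv w ^^ j) f p / fact j) + (dir_deriv w ^^ k) f (p + t *\<^sub>R w) / fact k"
      by (rule Taylor_line[OF assms(2,3) seg])
    have "\<bar>(dir_deriv w ^^ k) f (p + t *\<^sub>R w) / fact k\<bar> \<le> \<bar>(dir_deriv w ^^ k) f (p + t *\<^sub>R w)\<bar>"
      using divide_left_mono[OF fact_ge_1, of "\<bar>(dir_deriv w ^^ k) f (p + t *\<^sub>R w)\<bar>" k]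
      by (simp add: abs_divide)
    also have "\<dots> \<le> M * norm w ^ k"
      using t by (intro M in_ball) auto
    finally show ?thesis using t(3) by simp
  qed
  then show ?thesis
    by (intro that[OF M(1) r(1)]) blast
qed

text \<open>The second difference of f over a small parallelogram equals s^2 times either mixed
  derivative, each at some point of it. Continuity at p then excludes two different values
  there.\<close>

lemma dir_deriv_commute:
  fixes f :: "'a::euclidean_space \<Rightarrow> real"
  assumes "open S" "Ck_on 2 f S" "p \<in> S"
  shows "dir_deriv u (dir_deriv v f) p = dir_deriv v (dir_deriv u f) p"
proof (rule ccontr)
  assume neq: "dir_deriv u (dir_deriv v f) p \<noteq> dir_deriv v (dir_deriv u f) p"
  have C1: "Ck_on (Suc 0) f S" "Ck_on (Suc 0) (dir_deriv w f) S" for w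
    using Ck_on_mono[OF assms(2), of "Suc 0"] Ck_on_dir_deriv[of "Suc 0" f S w] assms(2)
    by (simp_all add: numeral_2_eq_2 del: Ck_on.simps)
  have cont: "isCont (dir_deriv v (dir_deriv w f)) p" for v w
    using Ck_on_dir_deriv[OF C1(2), of v w] assms by (simp add: continuous_on_eq_continuous_at)
  \<comment> \<open>Half the supposed gap: one number cannot be closer than this to both mixed
    derivatives at p.\<close>
  define \<epsilon> where "\<epsilon> = \<bar>dir_deriv u (dir_deriv v f) p - dir_deriv v (dir_deriv u f) p\<bar> / 2"
  have "\<epsilon> > 0" using neq by (simp add: \<epsilon>_def)
  obtain r where r: "r > 0" "ball p r \<subseteq> S"
    using assms by (meson open_contains_ball)
  obtain d1 where d1: "d1 > 0" "\<And>x. dist x p < d1 \<Longrightarrow> \<bar>dir_deriv u (dir_deriv v f) x - dir_deriv u (dir_deriv v f) p\<bar> < \<epsilon>"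
    using cont[of u v] \<open>\<epsilon> > 0\<close> unfolding continuous_at_eps_delta dist_real_def by blast
  obtain d2 where d2: "d2 > 0" "\<And>x. dist x p < d2 \<Longrightarrow> \<bar>dir_deriv v (dir_deriv u f) x - dir_deriv v (dir_deriv u f) p\<bar> < \<epsilon>"
    using cont[of v u] \<open>\<epsilon> > 0\<close> unfolding continuous_at_eps_delta dist_real_def by blast
  define d where "d = min r (min d1 d2)"
  have "d > 0" using r d1 d2 by (simp add: d_def)
  \<comment> \<open>Keeps the parallelogram with sides s u and s v within d/2 of p; the summand 1
    prevents division by zero when u = v = 0.\<close>
  define s where "s = d / (2 * (norm u + norm v + 1))"
  have "s > 0"
    using \<open>d > 0\<close> by (simp add: s_def add_nonneg_pos)
  have near: "dist (p + \<xi> *\<^sub>R u + \<eta> *\<^sub>R v) p < d" if "0 \<le> \<xi>" "\<xi> \<le> s" "0 \<le> \<eta>" "\<eta> \<le> s" for \<xi> \<eta>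
  proof -
    have "dist (p + \<xi> *\<^sub>R u + \<eta> *\<^sub>R v) p \<le> \<xi> * norm u + \<eta> * norm v"
      using norm_triangle_ineq[of "\<xi> *\<^sub>R u" "\<eta> *\<^sub>R v"] that by (simp add: dist_norm add.assoc)
    also have "\<dots> \<le> s * norm u + s * norm v"
      using that by (intro add_mono mult_right_mono) auto
    also have "\<dots> \<le> s * (norm u + norm v + 1)"
      using \<open>s > 0\<close> by (simp add: algebra_simps)
    also have "\<dots> = d / 2"
    proof -
      have "norm u + norm v + 1 \<noteq> 0"
        by (intro less_imp_neq[symmetric] add_nonneg_pos add_nonneg_nonneg) auto
      moreover have "d / (2 * K) * K = d / 2" if "K \<noteq> 0" for K
        using that by simp
      ultimately show ?thesis by (simp only: s_def)
    qed
    finally show ?thesis using \<open>d > 0\<close> by simp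
  qed
  \<comment> \<open>Stated for arbitrary directions, so that exchanging u and v yields the other
    mixed derivative for the same second difference.\<close>
  have square: "\<exists>\<xi> \<eta>. 0 \<le> \<xi> \<and> \<xi> \<le> s \<and> 0 \<le> \<eta> \<and> \<eta> \<le> s \<and>
      f (p + s *\<^sub>R u + s *\<^sub>R v) - f (p + s *\<^sub>R u) - f (p + s *\<^sub>R v) + f p
      = s * s * dir_deriv v (dir_deriv u f) (p + \<xi> *\<^sub>R u + \<eta> *\<^sub>R v)"
    if near: "\<And>\<xi> \<eta>. 0 \<le> \<xi> \<Longrightarrow> \<xi> \<le> s \<Longrightarrow> 0 \<le> \<eta> \<Longrightarrow> \<eta> \<le> s \<Longrightarrow> p + \<xi> *\<^sub>R u + \<eta> *\<^sub>R v \<in> S" for u v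
  proof -
    note line = has_real_derivative_line[of "Suc 0" _ S, OF _ zero_less_Suc]
    have "\<exists>\<xi>>0. \<xi> < s \<and> (f (p + s *\<^sub>R v + s *\<^sub>R u) - f (p + s *\<^sub>R u)) - (f (p + s *\<^sub>R v + 0 *\<^sub>R u) - f (p + 0 *\<^sub>R u))
      = (s - 0) * (dir_deriv u f (p + s *\<^sub>R v + \<xi> *\<^sub>R u) - dir_deriv u f (p + \<xi> *\<^sub>R u))"
    proof (rule MVT2[OF \<open>s > 0\<close>])
      fix t assume "0 \<le> t" "t \<le> s"
      then show "((\<lambda>t. f (p + s *\<^sub>R v + t *\<^sub>R u) - f (p + t *\<^sub>R u)) has_real_derivative
          dir_deriv u f (p + s *\<^sub>R v + t *\<^sub>R u) - dir_deriv u f (p + t *\<^sub>R u)) (at t)"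
        using near[of t s] near[of t 0] \<open>s > 0\<close>
        by (intro DERIV_diff line C1) (simp_all add: algebra_simps)
    qed
    then obtain \<xi> where xi: "0 < \<xi>" "\<xi> < s" "f (p + s *\<^sub>R v + s *\<^sub>R u) - f (p + s *\<^sub>R u) - (f (p + s *\<^sub>R v) - f p)
      = s * (dir_deriv u f (p + s *\<^sub>R v + \<xi> *\<^sub>R u) - dir_deriv u f (p + \<xi> *\<^sub>R u))"
      by auto
    have "\<exists>\<eta>>0. \<eta> < s \<and> dir_deriv u f (p + \<xi> *\<^sub>R u + s *\<^sub>R v) - dir_deriv u f (p + \<xi> *\<^sub>R u + 0 *\<^sub>R v)
      = (s - 0) * dir_deriv v (dir_deriv u f) (p + \<xi> *\<^sub>R u + \<eta> *\<^sub>R v)"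
    proof (rule MVT2[OF \<open>s > 0\<close>])
      fix t assume "0 \<le> t" "t \<le> s"
      then show "((\<lambda>t. dir_deriv u f (p + \<xi> *\<^sub>R u + t *\<^sub>R v)) has_real_derivative
          dir_deriv v (dir_deriv u f) (p + \<xi> *\<^sub>R u + t *\<^sub>R v)) (at t)"
        using near[of \<xi> t] xi by (intro line C1) auto
    qed
    then obtain \<eta> where eta: "0 < \<eta>" "\<eta> < s" "dir_deriv u f (p + \<xi> *\<^sub>R u + s *\<^sub>R v) - dir_deriv u f (p + \<xi> *\<^sub>R u)
      = s * dir_deriv v (dir_deriv u f) (p + \<xi> *\<^sub>R u + \<eta> *\<^sub>R v)"
      by auto
    have "f (p + s *\<^sub>R u + s *\<^sub>R v) - f (p + s *\<^sub>R u) - f (p + s *\<^sub>R v) + f p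
      = s * (s * dir_deriv v (dir_deriv u f) (p + \<xi> *\<^sub>R u + \<eta> *\<^sub>R v))"
      unfolding eta(3)[symmetric] using xi(3) by (simp add: algebra_simps)
    with xi eta show ?thesis by (intro exI[of _ \<xi>] exI[of _ \<eta>]) auto
  qed
  have in_S: "p + \<xi> *\<^sub>R u + \<eta> *\<^sub>R v \<in> S" if "0 \<le> \<xi>" "\<xi> \<le> s" "0 \<le> \<eta>" "\<eta> \<le> s" for \<xi> \<eta>
    using near[OF that] r(2) by (auto simp: d_def dist_commute)
  have in_S': "p + \<xi> *\<^sub>R v + \<eta> *\<^sub>R u \<in> S" if "0 \<le> \<xi>" "\<xi> \<le> s" "0 \<le> \<eta>" "\<eta> \<le> s" for \<xi> \<eta>
    using in_S[OF that(3,4,1,2)] by (simp only: add_ac)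
  obtain \<xi> \<eta> where 1: "0 \<le> \<xi>" "\<xi> \<le> s" "0 \<le> \<eta>" "\<eta> \<le> s"
    "f (p + s *\<^sub>R u + s *\<^sub>R v) - f (p + s *\<^sub>R u) - f (p + s *\<^sub>R v) + f p
      = s * s * dir_deriv v (dir_deriv u f) (p + \<xi> *\<^sub>R u + \<eta> *\<^sub>R v)"
    using square[OF in_S] by blast
  obtain \<xi>' \<eta>' where 2: "0 \<le> \<xi>'" "\<xi>' \<le> s" "0 \<le> \<eta>'" "\<eta>' \<le> s"
    "f (p + s *\<^sub>R v + s *\<^sub>R u) - f (p + s *\<^sub>R v) - f (p + s *\<^sub>R u) + f p
      = s * s * dir_deriv u (dir_deriv v f) (p + \<xi>' *\<^sub>R v + \<eta>' *\<^sub>R u)"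
    using square[OF in_S'] by blast
  have "dir_deriv v (dir_deriv u f) (p + \<xi> *\<^sub>R u + \<eta> *\<^sub>R v) = dir_deriv u (dir_deriv v f) (p + \<eta>' *\<^sub>R u + \<xi>' *\<^sub>R v)"
    using 1(5) 2(5) \<open>s > 0\<close> by (simp add: algebra_simps)
  moreover have "\<bar>dir_deriv v (dir_deriv u f) (p + \<xi> *\<^sub>R u + \<eta> *\<^sub>R v) - dir_deriv v (dir_deriv u f) p\<bar> < \<epsilon>"
    using near[OF 1(1-4)] by (intro d2) (simp add: d_def)
  moreover have "\<bar>dir_deriv u (dir_deriv v f) (p + \<eta>' *\<^sub>R u + \<xi>' *\<^sub>R v) - dir_deriv u (dir_deriv v f) p\<bar> < \<epsilon>"
    using near[OF 2(3,4,1,2)] by (intro d1) (simp add: d_def)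
  moreover have "\<bar>A - B\<bar> \<le> \<bar>x - A\<bar> + \<bar>x - B\<bar>" for x A B :: real
    by linarith
  ultimately show False unfolding \<epsilon>_def by (smt (verit) field_sum_of_halves)
qed

section \<open>Quadratic normal form in the plane\<close>

text \<open>A named gauge gives all order estimates one shape in which only the exponent has to be
  matched.\<close>

definition norm_pow :: "nat \<Rightarrow> 'a::real_normed_vector \<Rightarrow> real" where
  "norm_pow k = (\<lambda>x. norm x ^ k)"

lemma bigo_norm_iff:
  fixes f :: "'a::real_normed_vector \<Rightarrow> real"
  shows "f \<in> O[at 0](norm_pow k) \<longleftrightarrow>
    (\<exists>c>0. \<exists>r>0. \<forall>x. x \<noteq> 0 \<and> norm x < r \<longrightarrow> \<bar>f x\<bar> \<le> c * norm x ^ k)"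
  by (auto simp: bigo_def eventually_at dist_norm norm_pow_def)

lemma bigo_norm_mono:
  fixes f :: "'a::real_normed_vector \<Rightarrow> real"
  assumes "f \<in> O[at 0](norm_pow m)" "k \<le> m"
  shows "f \<in> O[at 0](norm_pow k)"
proof -
  have "(norm_pow m :: 'a \<Rightarrow> real) \<in> O[at 0](norm_pow k)"
    unfolding bigo_norm_iff using assms(2)
    by (intro exI[of _ 1] conjI allI impI) (auto simp: norm_pow_def intro: power_decreasing)
  with assms(1) show ?thesis by (rule landau_o.big_trans)
qed

lemma bigo_norm_mult:
  fixes f g :: "'a::real_normed_vector \<Rightarrow> real"
  assumes "f \<in> O[at 0](norm_pow m)" "g \<in> O[at 0](norm_pow l)" "m + l = k"
  shows "(\<lambda>x. f x * g x) \<in> O[at 0](norm_pow k)"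
  using landau_o.big.mult[OF assms(1,2)] by (simp add: norm_pow_def power_add flip: assms(3))

lemma fst_snd_bigo_norm:
  shows "(fst :: real \<times> real \<Rightarrow> real) \<in> O[at 0](norm_pow 1)"
    and "(snd :: real \<times> real \<Rightarrow> real) \<in> O[at 0](norm_pow 1)"
proof -
  have "\<bar>fst y\<bar> \<le> norm y" "\<bar>snd y\<bar> \<le> norm y" for y :: "real \<times> real"
    using norm_fst_le[of "fst y" "snd y"] norm_snd_le[of "snd y" "fst y"] by auto
  then show "(fst :: real \<times> real \<Rightarrow> real) \<in> O[at 0](norm_pow 1)"
    and "(snd :: real \<times> real \<Rightarrow> real) \<in> O[at 0](norm_pow 1)"
    by (auto simp: norm_pow_def intro!: bigoI[where c=1] always_eventually)
qed

text \<open>The filter \<open>at 0\<close> is punctured, so the value at 0 has to be prescribed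
  separately.\<close>

lemma bigo_square_has_derivative_0:
  fixes f :: "'a::real_normed_vector \<Rightarrow> real"
  assumes "f \<in> O[at 0](norm_pow 2)" "f 0 = 0"
  shows "(f has_derivative (\<lambda>_. 0)) (at 0)"
proof -
  obtain c r where c: "c > 0" "r > 0" "\<And>x. x \<noteq> 0 \<Longrightarrow> norm x < r \<Longrightarrow> \<bar>f x\<bar> \<le> c * norm x ^ 2"
    using assms(1) unfolding bigo_norm_iff by blast
  have "((\<lambda>h. norm (f (0 + h) - f 0 - 0) / norm h) \<longlongrightarrow> 0) (at 0)"
  proof (rule tendsto_sandwich[of "\<lambda>_. 0" _ _ "\<lambda>h. c * norm h"])
    show "\<forall>\<^sub>F h in at 0. norm (f (0 + h) - f 0 - 0) / norm h \<le> c * norm h"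
      unfolding eventually_at
    proof (intro exI[of _ r] conjI ballI impI)
      fix x :: 'a assume "x \<noteq> 0 \<and> dist x 0 < r"
      with c(3)[of x] show "norm (f (0 + x) - f 0 - 0) / norm x \<le> c * norm x"
        by (simp add: assms(2) divide_le_eq power2_eq_square)
    qed (use c in auto)
    show "((\<lambda>h::'a. c * norm h) \<longlongrightarrow> 0) (at 0)"
      by (auto intro!: tendsto_eq_intros)
  qed auto
  then show ?thesis by (simp add: has_derivative_at bounded_linear_zero)
qed

(* In f(y + s v) - f(y - s v) with s = |y| the second-order Taylor terms cancel. *)
lemma dir_deriv_bigo:
  fixes f :: "'a::euclidean_space \<Rightarrow> real"
  assumes "open S" "0 \<in> S" "Ck_on 3 f S" "f \<in> O[at 0](norm_pow 3)" "f 0 = 0"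
  shows "dir_deriv v f \<in> O[at 0](norm_pow 2)"
proof -
  obtain r1 where r1: "r1 > 0" "cball 0 r1 \<subseteq> S"
    using assms by (meson open_contains_cball)
  obtain M where M: "M \<ge> 0" "\<And>x w. x \<in> cball 0 r1 \<Longrightarrow> \<bar>(dir_deriv w ^^ 3) f x\<bar> \<le> M * norm w ^ 3"
    using dir_deriv_funpow_bound[OF assms(1) compact_cball r1(2) assms(3)] by blast
  obtain c r2 where c0: "c > 0" "r2 > 0" "\<And>x. x \<noteq> 0 \<Longrightarrow> norm x < r2 \<Longrightarrow> \<bar>f x\<bar> \<le> c * norm x ^ 3"
    using assms(4) unfolding bigo_norm_iff by blast
  have c: "\<bar>f x\<bar> \<le> c * norm x ^ 3" if "norm x < r2" for x
    by (cases "x = 0") (use c0(3) that assms(5) in auto)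
  \<comment> \<open>The step length will be s = |y|, so all intermediate points y + t e v with |e| =
    s lie within s L of 0.\<close>
  define L where "L = 1 + norm v"
  have "L > 0" unfolding L_def by (simp add: add_pos_nonneg)
  define r where "r = min r1 r2 / (2 * L)"
  have "r > 0" using r1 c0 \<open>L > 0\<close> by (simp add: r_def)
  \<comment> \<open>Subtracting the two expansions bounds s |D_v f(y)| by c (s L)^3 + M (s |v|)^3 /
    6. Dividing by s gives K s^2, with the factor 1/6 dropped.\<close>
  define K where "K = c * L ^ 3 + M * norm v ^ 3"
  have "\<bar>dir_deriv v f y\<bar> \<le> K * norm y ^ 2" if y: "y \<noteq> 0" "norm y < r" for y
  proof -
    define s where "s = norm y"
    have "s > 0" using y by (simp add: s_def)
    have "s * (2 * L) < min r1 r2"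
      using y(2) \<open>L > 0\<close> by (simp add: s_def r_def pos_less_divide_eq del: min_less_iff_conj)
    moreover have "s * L \<le> s * (2 * L)"
      using \<open>s > 0\<close> \<open>L > 0\<close> by simp
    ultimately have s: "s > 0" "s * L < min r1 r2"
      using \<open>s > 0\<close> by linarith+
    have near: "norm (y + t *\<^sub>R (e *\<^sub>R v)) \<le> s * L" if "0 \<le> t" "t \<le> 1" "\<bar>e\<bar> = s" for t e
    proof -
      have "norm (y + t *\<^sub>R (e *\<^sub>R v)) \<le> s + t * (s * norm v)"
        using norm_triangle_ineq[of y "t *\<^sub>R (e *\<^sub>R v)"] that by (simp add: s_def abs_mult)
      also have "\<dots> \<le> s + 1 * (s * norm v)"
        using that s by (intro add_left_mono mult_right_mono) auto
      finally show ?thesis by (simp add: L_def algebra_simps)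
    qed
    have est: "\<exists>R. f (y + e *\<^sub>R v) = f y + e * dir_deriv v f y + e\<^sup>2 * (dir_deriv v ^^ 2) f y / 2 + R \<and> \<bar>R\<bar> \<le> M * (s * norm v) ^ 3 / 6"
      if e: "\<bar>e\<bar> = s" for e
    proof -
      have seg: "y + t *\<^sub>R (e *\<^sub>R v) \<in> S" if "0 \<le> t" "t \<le> 1" for t
        using near[OF that e] s r1(2) by (auto simp: subset_iff)
      obtain t where t: "0 < t" "t < 1" "f (y + e *\<^sub>R v) =
          (\<Sum>j<3. (dir_deriv (e *\<^sub>R v) ^^ j) f y / fact j) + (dir_deriv (e *\<^sub>R v) ^^ 3) f (y + t *\<^sub>R (e *\<^sub>R v)) / fact 3"
        by (rule Taylor_line[OF assms(3) _ seg]) simp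
      have "y \<in> S" using seg[of 0] by simp
      have "dir_deriv (e *\<^sub>R v) f y = e * dir_deriv v f y"
        using linear_scale[OF dir_deriv_linear[OF assms(3) _ \<open>y \<in> S\<close>]] by simp
      moreover have "(dir_deriv (e *\<^sub>R v) ^^ 2) f y = e\<^sup>2 * (dir_deriv v ^^ 2) f y"
        by (rule dir_deriv_funpow_scale[OF assms(1) Ck_on_mono[OF assms(3)] \<open>y \<in> S\<close>]) simp
      ultimately have "f (y + e *\<^sub>R v) = f y + e * dir_deriv v f y + e\<^sup>2 * (dir_deriv v ^^ 2) f y / 2
          + (dir_deriv (e *\<^sub>R v) ^^ 3) f (y + t *\<^sub>R (e *\<^sub>R v)) / fact 3"
        using t(3) by (simp add: numeral_3_eq_3 numeral_2_eq_2)
      moreover have "\<bar>(dir_deriv (e *\<^sub>R v) ^^ 3) f (y + t *\<^sub>R (e *\<^sub>R v))\<bar> \<le> M * norm (e *\<^sub>R v) ^ 3"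
        using near[OF _ _ e, of t] s t by (intro M) auto
      ultimately show ?thesis
        using e by (intro exI conjI) (assumption, simp add: fact_numeral divide_right_mono)
    qed
    obtain R1 where R1: "f (y + s *\<^sub>R v) = f y + s * dir_deriv v f y + s\<^sup>2 * (dir_deriv v ^^ 2) f y / 2 + R1" "\<bar>R1\<bar> \<le> M * (s * norm v) ^ 3 / 6"
      using est[of s] s by auto
    obtain R2 where R2: "f (y + (-s) *\<^sub>R v) = f y - s * dir_deriv v f y + s\<^sup>2 * (dir_deriv v ^^ 2) f y / 2 + R2" "\<bar>R2\<bar> \<le> M * (s * norm v) ^ 3 / 6"
      using est[of "-s"] s by auto
    have "\<bar>f (y + e *\<^sub>R v)\<bar> \<le> c * (s * L) ^ 3" if "\<bar>e\<bar> = s" for e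
    proof -
      have "\<bar>f (y + e *\<^sub>R v)\<bar> \<le> c * norm (y + e *\<^sub>R v) ^ 3"
        using near[of 1 e] s that by (intro c) auto
      also have "\<dots> \<le> c * (s * L) ^ 3"
        using near[of 1 e] that c0(1) by (intro mult_left_mono power_mono) auto
      finally show ?thesis .
    qed
    from this[of s] this[of "-s"] have "\<bar>f (y + s *\<^sub>R v)\<bar> \<le> c * (s * L) ^ 3" "\<bar>f (y + (-s) *\<^sub>R v)\<bar> \<le> c * (s * L) ^ 3"
      using s by auto
    then have "\<bar>s * dir_deriv v f y\<bar> \<le> c * (s * L) ^ 3 + M * (s * norm v) ^ 3 / 6"
      using R1 R2 by linarith
    also have "\<dots> \<le> s * (K * s ^ 2)"
      using M(1) s by (simp add: K_def power_mult_distrib power2_eq_square power3_eq_cube algebra_simps)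
    finally show ?thesis
      using s by (simp add: abs_mult s_def[symmetric])
  qed
  moreover have "K + 1 > 0"
    using c0(1) M(1) \<open>L > 0\<close> by (simp add: K_def add_nonneg_pos)
  moreover have "K * norm y ^ 2 \<le> (K + 1) * norm y ^ 2" for y :: 'a
    by (simp add: mult_right_mono)
  ultimately show ?thesis
    unfolding bigo_norm_iff using \<open>r > 0\<close>
    by (intro exI[of _ "K + 1"] conjI exI[of _ r] allI impI) (auto intro: order_trans)
qed

text \<open>On a small ball the difference of \<Psi> and the identity is 1/2-Lipschitz. This yields
  injectivity, invertible derivatives, and the lower bound that later turns estimates in y into
  estimates in \<Psi> y.\<close>

lemma local_coordinates_near_identity:
  fixes \<Psi> :: "real \<times> real \<Rightarrow> real \<times> real"
  assumes "open V" "0 \<in> V" "Ck_on 3 \<Psi> V" "\<Psi> 0 = 0" "(\<Psi> has_derivative (\<lambda>v. v)) (at 0)"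
  obtains N where "N \<subseteq> V" "local_coordinates \<Psi> N" "\<forall>y\<in>N. norm y \<le> 2 * norm (\<Psi> y)"
proof -
  let ?D = "\<lambda>y. frechet_derivative \<Psi> (at y)"
  have D: "(\<Psi> has_derivative ?D y) (at y)" if "y \<in> V" for y
    using Ck_on_has_derivative[OF assms(3) _ that] by simp
  have "\<forall>\<^sub>F y in nhds 0. norm (?D y b - b) < 1/4" for b
  proof -
    have "Ck_on (Suc 2) \<Psi> V"
      using assms(3) by (simp add: eval_nat_numeral del: Ck_on.simps)
    then have "Ck_on 2 (\<lambda>y. ?D y b) V"
      by (rule Ck_on_frechet_derivative)
    then have "isCont (\<lambda>y. ?D y b) 0"
      using Ck_on_imp_continuous_on assms(1,2) continuous_on_eq_continuous_at by blast
    then have "isCont (\<lambda>y. norm (?D y b - b)) 0"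
      by (intro continuous_intros)
    then have "((\<lambda>y. norm (?D y b - b)) \<longlongrightarrow> norm (?D 0 b - b)) (nhds 0)"
      unfolding isCont_def tendsto_at_iff_tendsto_nhds[of "\<lambda>y. norm (?D y b - b)"] .
    moreover have "?D 0 b = b"
      using fun_cong[OF frechet_derivative_at[OF assms(5)], of b] by simp
    ultimately show ?thesis
      using order_tendstoD(2)[of "\<lambda>y. norm (?D y b - b)" _ "nhds 0" "1/4"] by simp
  qed
  then have "\<forall>\<^sub>F y in nhds 0. norm (?D y (1,0) - (1,0)) < 1/4 \<and> norm (?D y (0,1) - (0,1)) < 1/4 \<and> y \<in> V"
    using assms(1,2) by (intro eventually_conj) (auto simp: eventually_nhds_in_open)
  then obtain \<rho> where rho: "\<rho> > 0" and est: "\<And>y. dist y 0 < \<rho> \<Longrightarrow>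
      norm (?D y (1,0) - (1,0)) < 1/4 \<and> norm (?D y (0,1) - (0,1)) < 1/4 \<and> y \<in> V"
    unfolding eventually_nhds_metric by blast
  define N :: "(real \<times> real) set" where "N = ball 0 \<rho>"
  have N: "N \<subseteq> V" "open N" "0 \<in> N" "convex N"
    using est rho by (auto simp: N_def dist_commute)
  \<comment> \<open>Each of the two coordinate directions contributes an error of at most
    |v|/4.\<close>
  have D_est: "norm (?D y v - v) \<le> 1/2 * norm v" if "y \<in> N" for y v
  proof -
    have "y \<in> V" using that N by blast
    then have lin: "linear (?D y)" using D has_derivative_linear by blast
    obtain v1 v2 where v: "v = (v1, v2)" by (cases v)
    have vv: "(v1, v2) = v1 *\<^sub>R (1, 0) + v2 *\<^sub>R (0, 1)" by simp
    have "?D y (v1, v2) = v1 *\<^sub>R ?D y (1, 0) + v2 *\<^sub>R ?D y (0, 1)"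
      unfolding vv linear_add[OF lin] linear_scale[OF lin] ..
    then have "?D y v - v = v1 *\<^sub>R (?D y (1, 0) - (1, 0)) + v2 *\<^sub>R (?D y (0, 1) - (0, 1))"
      unfolding v scaleR_diff_right by (simp only: vv) (simp add: algebra_simps)
    also have "norm \<dots> \<le> \<bar>v1\<bar> * norm (?D y (1, 0) - (1, 0)) + \<bar>v2\<bar> * norm (?D y (0, 1) - (0, 1))"
      by (rule order_trans[OF norm_triangle_ineq]) (simp only: norm_scaleR real_norm_def order_refl)
    also have "\<dots> \<le> norm v * (1/4) + norm v * (1/4)"
      using est[of y] that norm_fst_le[of v1 v2] norm_snd_le[of v2 v1]
      by (intro add_mono mult_mono) (auto simp: N_def v dist_commute intro: less_imp_le)
    finally show ?thesis by simp
  qed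
  have lip: "norm ((\<Psi> x - x) - (\<Psi> y - y)) \<le> 1/2 * norm (x - y)" if "x \<in> N" "y \<in> N" for x y
  proof (rule differentiable_bound[where f="\<lambda>x. \<Psi> x - x" and f'="\<lambda>z v. ?D z v - v" and S=N])
    show "((\<lambda>x. \<Psi> x - x) has_derivative (\<lambda>v. ?D z v - v)) (at z within N)" if "z \<in> N" for z
      using that N(1) by (intro has_derivative_diff has_derivative_ident has_derivative_at_withinI[OF D]) blast
    show "onorm (\<lambda>v. ?D z v - v) \<le> 1/2" if "z \<in> N" for z
      using D_est[OF that] by (intro onorm_le)
  qed (use N that in auto)
  have lower: "norm (x - y) \<le> 2 * norm (\<Psi> x - \<Psi> y)" if "x \<in> N" "y \<in> N" for x y
  proof -
    have "norm (x - y) - norm (\<Psi> x - \<Psi> y) \<le> norm ((x - y) - (\<Psi> x - \<Psi> y))"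
      by (rule norm_triangle_ineq2)
    also have "\<dots> = norm ((\<Psi> x - x) - (\<Psi> y - y))"
      by (subst norm_minus_commute) (simp add: algebra_simps)
    finally show ?thesis using lip[OF that] by simp
  qed
  have "inj_on \<Psi> N"
  proof (rule inj_onI)
    fix x y assume "x \<in> N" "y \<in> N" "\<Psi> x = \<Psi> y"
    with lower[of x y] show "x = y" by simp
  qed
  moreover have "bij (?D y)" if "y \<in> N" for y
  proof -
    have lin: "linear (?D y)" using that N D has_derivative_linear by blast
    have "inj (?D y)"
      unfolding linear_injective_0[OF lin]
    proof (intro allI impI)
      fix v assume "?D y v = 0"
      with D_est[OF that, of v] show "v = 0" by simp
    qed
    then show ?thesis
      using linear_injective_imp_surjective[OF lin] by (simp add: bij_def)
  qed
  ultimately have "local_coordinates \<Psi> N"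
    unfolding local_coordinates_def
    by (intro conjI ballI N Ck_on_subset[OF assms(3)] assms(4))
  moreover have "\<forall>y\<in>N. norm y \<le> 2 * norm (\<Psi> y)"
    using lower[OF _ N(3)] assms(4) by simp
  ultimately show ?thesis by (rule that[OF N(1)])
qed

text \<open>Modulo cubic terms the derivative of the second new coordinate is b20 y1^2 + (2 a20 +
  b11) y1 y2 + (b02 + a11 + 2 alpha) y2^2, which explains \<open>a\<close>, \<open>b\<close> and the
  choice of alpha. The free cubic term \<open>r2\<close> lets one argument serve both the purely
  quadratic and the exact version.\<close>

lemma planar_change:
  fixes Y1 Y2 r2 :: "real \<times> real \<Rightarrow> real"
  assumes V: "open V" "0 \<in> V"
    and Y1: "(\<lambda>y. Y1 y - (snd y + a20 * (fst y)\<^sup>2 + a11 * (fst y * snd y) + a02 * (snd y)\<^sup>2)) \<in> O[at 0](norm_pow 3)"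
    and Y2: "(\<lambda>y. Y2 y - (b20 * (fst y)\<^sup>2 + b11 * (fst y * snd y) + b02 * (snd y)\<^sup>2)) \<in> O[at 0](norm_pow 3)"
    and \<alpha>: "\<alpha> = - (b02 + a11) / 2" and ab: "a = b20" "b = 2 * a20 + b11"
    and r2: "Ck_on 3 r2 V" "r2 \<in> O[at 0](norm_pow 3)" "r2 0 = 0"
    and \<Psi>_def: "\<Psi> = (\<lambda>y. (fst y + \<alpha> * (fst y)\<^sup>2,
      snd y + (a20 * (fst y)\<^sup>2 + (a11 + 2 * \<alpha>) * (fst y * snd y) + a02 * (snd y)\<^sup>2) + r2 y))"
  obtains N Z where "N \<subseteq> V" "local_coordinates \<Psi> N" "vf_related \<Psi> N (\<lambda>y. (Y1 y, Y2 y)) Z"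
    "bt_field_mod_cubic a b Z" "\<forall>y\<in>N. fst (Z (\<Psi> y)) = Y1 y + 2 * \<alpha> * fst y * Y1 y"
proof -
  define D where "D y \<eta> = (fst \<eta> + 2 * \<alpha> * fst y * fst \<eta>,
      snd \<eta> + (2 * a20 * fst y * fst \<eta> + (a11 + 2 * \<alpha>) * (fst y * snd \<eta> + snd y * fst \<eta>) + 2 * a02 * snd y * snd \<eta>)
        + dir_deriv \<eta> r2 y)" for y \<eta>
  have \<Psi>_D: "(\<Psi> has_derivative D y) (at y)" if "y \<in> V" for y
  proof -
    have "(r2 has_derivative (\<lambda>\<eta>. dir_deriv \<eta> r2 y)) (at y)"
      unfolding dir_deriv_def using Ck_on_has_derivative[OF r2(1) _ that] by simp
    then show ?thesis
      unfolding \<Psi>_def D_def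
      by (auto intro!: derivative_eq_intros simp: algebra_simps power2_eq_square)
  qed
  have "Ck_on 3 (\<lambda>y::real\<times>real. fst y) V" "Ck_on 3 (\<lambda>y::real\<times>real. snd y) V"
    using V by (auto intro!: Ck_on_bounded_linear bounded_linear_fst bounded_linear_snd)
  then have C3: "Ck_on 3 \<Psi> V"
    unfolding \<Psi>_def power2_eq_square
    by (intro Ck_on_Pair Ck_on_add Ck_on_bilinear[OF bounded_bilinear_mult] Ck_on_const r2(1) V)
  have "(r2 has_derivative (\<lambda>_. 0)) (at 0)"
    using r2 by (intro bigo_square_has_derivative_0 bigo_norm_mono[of r2 3 2]) auto
  then have "dir_deriv \<eta> r2 0 = 0" for \<eta>
    unfolding dir_deriv_def by (metis frechet_derivative_at)
  then have "D 0 = (\<lambda>v. v)"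
    by (auto simp: D_def)
  then have \<Psi>_id: "(\<Psi> has_derivative (\<lambda>v. v)) (at 0)"
    using \<Psi>_D[OF V(2)] by simp
  have "\<Psi> 0 = 0"
    by (simp add: \<Psi>_def r2(3)) (simp add: zero_prod_def)
  obtain N where N: "N \<subseteq> V" "local_coordinates \<Psi> N" "\<forall>y\<in>N. norm y \<le> 2 * norm (\<Psi> y)"
    by (rule local_coordinates_near_identity[OF V C3 \<open>\<Psi> 0 = 0\<close> \<Psi>_id])
  define W where "W y = D y (Y1 y, Y2 y)" for y
  define nf where "nf u = (snd u, a * (fst u)\<^sup>2 + b * fst u * snd u)" for u :: "real \<times> real"
  \<comment> \<open>Outside the image of the chart the value is arbitrary; the normal form itself is chosen there, so that
    the image need not be shown to be a neighbourhood of 0.\<close>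
  define Z where "Z u = (if u \<in> \<Psi> ` N then W (inv_into N \<Psi> u) else nf u)" for u
  have Z: "Z (\<Psi> y) = W y" if "y \<in> N" for y
    using that N(2) by (simp add: Z_def local_coordinates_def)
  note mult = bigo_norm_mult
  have mono: "f \<in> O[at 0](norm_pow 2)" if "f \<in> O[at 0](norm_pow 3)" for f :: "real \<times> real \<Rightarrow> real"
    using that by (rule bigo_norm_mono) simp
  note y1 = fst_snd_bigo_norm(1) and y2 = fst_snd_bigo_norm(2)
  have q: "(\<lambda>y. p20 * (fst y)\<^sup>2 + p11 * (fst y * snd y) + p02 * (snd y)\<^sup>2) \<in> O[at 0](norm_pow 2)" for p20 p11 p02
    using mult[OF y1 y1, of 2] mult[OF y1 y2, of 2] mult[OF y2 y2, of 2]
    unfolding power2_eq_square by (intro sum_in_bigo) simp_all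
  define T1 where "T1 y = Y1 y - snd y" for y
  have T1: "T1 \<in> O[at 0](norm_pow 2)"
    using sum_in_bigo(1)[OF mono[OF Y1] q[of a20 a11 a02]] by (simp add: T1_def[abs_def] algebra_simps)
  have Y2': "Y2 \<in> O[at 0](norm_pow 2)"
    using sum_in_bigo(1)[OF mono[OF Y2] q[of b20 b11 b02]] by (simp add: algebra_simps)
  have lin1: "f \<in> O[at 0](norm_pow 1)" if "f \<in> O[at 0](norm_pow 2)" for f
    using bigo_norm_mono[OF that] by simp
  have Y1': "Y1 \<in> O[at 0](norm_pow 1)"
    using sum_in_bigo(1)[OF lin1[OF T1] y2] by (simp add: T1_def)
  define S where "S y = a20 * (fst y)\<^sup>2 + (a11 + 2 * \<alpha>) * (fst y * snd y) + a02 * (snd y)\<^sup>2 + r2 y" for y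
  have S: "S \<in> O[at 0](norm_pow 2)"
    unfolding S_def by (intro sum_in_bigo(1)[OF q] mono r2(2))
  define P1 where "P1 y = fst y + \<alpha> * (fst y)\<^sup>2" for y :: "real \<times> real"
  have sq: "(\<lambda>y::real\<times>real. \<alpha> * (fst y)\<^sup>2) \<in> O[at 0](norm_pow 2)"
    using q[of \<alpha> 0 0] by simp
  have P1: "P1 \<in> O[at 0](norm_pow 1)"
    unfolding P1_def by (intro sum_in_bigo y1 lin1 sq)
  \<comment> \<open>The field is O(|y|) and by \<open>dir_deriv_bigo\<close> the derivative of r2 is
    O(|y|^2), so r2 changes the second component at third order only.\<close>
  have ddr: "(\<lambda>y. dir_deriv (Y1 y, Y2 y) r2 y) \<in> O[at 0](norm_pow 3)"
  proof -
    have "(\<lambda>y. Y1 y * dir_deriv (1,0) r2 y + Y2 y * dir_deriv (0,1) r2 y) \<in> O[at 0](norm_pow 3)"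
      by (intro sum_in_bigo mult[OF Y1' dir_deriv_bigo[OF V r2]] mult[OF lin1[OF Y2'] dir_deriv_bigo[OF V r2]]) simp_all
    moreover have "\<forall>\<^sub>F y in at 0. Y1 y * dir_deriv (1,0) r2 y + Y2 y * dir_deriv (0,1) r2 y = dir_deriv (Y1 y, Y2 y) r2 y"
      using eventually_at_in_open'[OF V]
    proof eventually_elim
      case (elim y)
      have lin: "linear (\<lambda>v. dir_deriv v r2 y)" using dir_deriv_linear[OF r2(1) _ elim] by simp
      have "(Y1 y, Y2 y) = Y1 y *\<^sub>R (1,0) + Y2 y *\<^sub>R (0,1)" by simp
      then show ?case by (simp only: linear_add[OF lin] linear_scale[OF lin]) simp
    qed
    ultimately show ?thesis
      by (subst (asm) landau_o.big.in_cong) auto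
  qed
  have m12: "(\<lambda>y. c * (f y * g y)) \<in> O[at 0](norm_pow 3)" if "f \<in> O[at 0](norm_pow 1)" "g \<in> O[at 0](norm_pow 2)" for f g c
    using mult[OF that, of 3] by simp
  have W1: "(\<lambda>y. fst (W y) - snd (\<Psi> y)) \<in> O[at 0](norm_pow 3)"
  proof -
    have "(\<lambda>y. (Y1 y - (snd y + a20 * (fst y)\<^sup>2 + a11 * (fst y * snd y) + a02 * (snd y)\<^sup>2))
        + (2 * \<alpha>) * (fst y * T1 y) - r2 y) \<in> O[at 0](norm_pow 3)"
      by (intro sum_in_bigo m12 Y1 y1 T1 r2(2))
    moreover have "(\<lambda>y. (Y1 y - (snd y + a20 * (fst y)\<^sup>2 + a11 * (fst y * snd y) + a02 * (snd y)\<^sup>2))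
        + (2 * \<alpha>) * (fst y * T1 y) - r2 y) = (\<lambda>y. fst (W y) - snd (\<Psi> y))"
      by (auto simp: W_def D_def \<Psi>_def T1_def algebra_simps)
    ultimately show ?thesis by simp
  qed
  have b02: "b02 = - a11 - 2 * \<alpha>"
    using \<alpha> by (simp add: field_simps)
  \<comment> \<open>The summands are the cubic errors made by replacing Y1 by y2 in the quadratic
    terms, by dropping products of y with Y2, and by replacing (u1, u2) by (y1, y2) in the target.
    Here \<open>P1\<close> is u1 and \<open>S\<close> is u2 - y2.\<close>
  have W2: "(\<lambda>y. snd (W y) - (a * (fst (\<Psi> y))\<^sup>2 + b * fst (\<Psi> y) * snd (\<Psi> y))) \<in> O[at 0](norm_pow 3)"
  proof -
    have "(\<lambda>y. (Y2 y - (b20 * (fst y)\<^sup>2 + b11 * (fst y * snd y) + b02 * (snd y)\<^sup>2))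
        + (2 * a20) * (fst y * T1 y) + (a11 + 2 * \<alpha>) * (fst y * Y2 y) + (a11 + 2 * \<alpha>) * (snd y * T1 y)
        + (2 * a02) * (snd y * Y2 y) + dir_deriv (Y1 y, Y2 y) r2 y
        - a * ((P1 y + fst y) * (\<alpha> * (fst y)\<^sup>2)) - b * ((snd y + S y) * (\<alpha> * (fst y)\<^sup>2)) - b * (fst y * S y))
       \<in> O[at 0](norm_pow 3)"
      by (intro sum_in_bigo m12 Y2 y1 y2 T1 Y2' ddr sq P1 S lin1[OF S])
    moreover have "(\<lambda>y. (Y2 y - (b20 * (fst y)\<^sup>2 + b11 * (fst y * snd y) + b02 * (snd y)\<^sup>2))
        + (2 * a20) * (fst y * T1 y) + (a11 + 2 * \<alpha>) * (fst y * Y2 y) + (a11 + 2 * \<alpha>) * (snd y * T1 y)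
        + (2 * a02) * (snd y * Y2 y) + dir_deriv (Y1 y, Y2 y) r2 y
        - a * ((P1 y + fst y) * (\<alpha> * (fst y)\<^sup>2)) - b * ((snd y + S y) * (\<alpha> * (fst y)\<^sup>2)) - b * (fst y * S y))
      = (\<lambda>y. snd (W y) - (a * (fst (\<Psi> y))\<^sup>2 + b * fst (\<Psi> y) * snd (\<Psi> y)))"
      unfolding W_def D_def \<Psi>_def T1_def P1_def S_def ab b02
      by (simp add: algebra_simps power2_eq_square)
    ultimately show ?thesis by simp
  qed
  \<comment> \<open>On the image of the chart |y| <= 2 |u|, which costs the factor 2^3 = 8; off the
    image F vanishes by the choice of Z.\<close>
  have transfer: "(\<lambda>u. F u) \<in> O[at 0](norm_pow 3)"
    if F: "(\<lambda>y. F (\<Psi> y)) \<in> O[at 0](norm_pow 3)" and outside: "\<And>u. u \<notin> \<Psi> ` N \<Longrightarrow> F u = 0" for F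
  proof -
    obtain c r where c: "c > 0" "r > 0" "\<And>y. y \<noteq> 0 \<Longrightarrow> norm y < r \<Longrightarrow> \<bar>F (\<Psi> y)\<bar> \<le> c * norm y ^ 3"
      using F unfolding bigo_norm_iff by blast
    have "\<bar>F u\<bar> \<le> (8 * c) * norm u ^ 3" if u: "u \<noteq> 0" "norm u < r / 2" for u
    proof (cases "u \<in> \<Psi> ` N")
      case True
      then obtain y where y: "y \<in> N" "u = \<Psi> y" by blast
      have "y \<noteq> 0" using u y \<open>\<Psi> 0 = 0\<close> by auto
      have le: "norm y \<le> 2 * norm u" using N(3) y by blast
      have "\<bar>F u\<bar> \<le> c * norm y ^ 3" using c(3) \<open>y \<noteq> 0\<close> le u y by simp
      also have "\<dots> \<le> c * (2 * norm u) ^ 3" using le c by (intro mult_left_mono power_mono) auto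
      finally show ?thesis by (simp add: power_mult_distrib)
    next
      case False
      then show ?thesis using outside c by simp
    qed
    then show ?thesis
      unfolding bigo_norm_iff using c by (intro exI[of _ "8 * c"] conjI exI[of _ "r / 2"]) auto
  qed
  have N_ev: "\<forall>\<^sub>F y in at 0. y \<in> N"
    using N(2) by (auto simp: local_coordinates_def intro!: eventually_at_in_open')
  have Z_ev: "\<forall>\<^sub>F y in at 0. Z (\<Psi> y) = W y"
    using N_ev by eventually_elim (rule Z)
  have "(\<lambda>y. fst (Z (\<Psi> y)) - snd (\<Psi> y)) \<in> O[at 0](norm_pow 3)"
    using W1 by (rule landau_o.big.in_cong[THEN iffD2, rotated])
      (use Z_ev in eventually_elim, simp)
  then have Z1: "(\<lambda>u. fst (Z u) - snd u) \<in> O[at 0](norm_pow 3)"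
    by (rule transfer) (simp add: Z_def nf_def)
  have "(\<lambda>y. snd (Z (\<Psi> y)) - (a * (fst (\<Psi> y))\<^sup>2 + b * fst (\<Psi> y) * snd (\<Psi> y))) \<in> O[at 0](norm_pow 3)"
    using W2 by (rule landau_o.big.in_cong[THEN iffD2, rotated])
      (use Z_ev in eventually_elim, simp)
  then have Z2: "(\<lambda>u. snd (Z u) - (a * (fst u)\<^sup>2 + b * fst u * snd u)) \<in> O[at 0](norm_pow 3)"
    by (rule transfer) (simp add: Z_def nf_def)
  have "bt_field_mod_cubic a b Z"
    unfolding bt_field_mod_cubic_def norm_pow_def[symmetric] using Z1 Z2 by (rule conjI)
  moreover have "vf_related \<Psi> N (\<lambda>y. (Y1 y, Y2 y)) Z"
    unfolding vf_related_def
  proof (intro ballI conjI)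
    fix y assume y: "y \<in> N"
    then have *: "(\<Psi> has_derivative D y) (at y)" using N \<Psi>_D by blast
    then show "\<Psi> differentiable (at y)" by (rule differentiableI)
    show "frechet_derivative \<Psi> (at y) (Y1 y, Y2 y) = Z (\<Psi> y)"
      using frechet_derivative_at[OF *] Z[OF y] by (simp add: W_def)
  qed
  ultimately show ?thesis
    using N by (intro that[of N Z]) (auto simp: Z W_def D_def)
qed

text \<open>\<open>planar_change\<close> is applied twice with the same Q: with zero correction for
  the quadratic change, and with a correction built from \<open>Y1\<close> for the exact first
  equation. The latter inherits its regularity from \<open>Y1\<close>.\<close>

lemma planar_normal_form:
  fixes Y1 Y2 :: "real \<times> real \<Rightarrow> real"
  assumes V: "open V" "0 \<in> V" and C3: "Ck_on 3 Y1 V" and Y10: "Y1 0 = 0"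
    and Y1: "(\<lambda>y. Y1 y - (snd y + a20 * (fst y)\<^sup>2 + a11 * (fst y * snd y) + a02 * (snd y)\<^sup>2)) \<in> O[at 0](norm_pow 3)"
    and Y2: "(\<lambda>y. Y2 y - (b20 * (fst y)\<^sup>2 + b11 * (fst y * snd y) + b02 * (snd y)\<^sup>2)) \<in> O[at 0](norm_pow 3)"
    and ab: "a = b20" "b = 2 * a20 + b11"
  shows "bt_normal_form a b (\<lambda>y. (Y1 y, Y2 y)) V"
proof -
  define \<alpha> where "\<alpha> = - (b02 + a11) / 2"
  define Q where "Q y = (\<alpha> * (fst y)\<^sup>2,
      a20 * (fst y)\<^sup>2 + (a11 + 2 * \<alpha>) * (fst y * snd y) + a02 * (snd y)\<^sup>2)" for y :: "real \<times> real"
  \<comment> \<open>With this cubic term the second new coordinate is exactly the time derivative of the first.\<close>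
  define r2 where "r2 y = Y1 y + 2 * \<alpha> * fst y * Y1 y - snd y
      - (a20 * (fst y)\<^sup>2 + (a11 + 2 * \<alpha>) * (fst y * snd y) + a02 * (snd y)\<^sup>2)" for y
  note change = planar_change[OF V Y1 Y2 \<alpha>_def ab]
  have Q: "homogeneous_quadratic Q"
    unfolding homogeneous_quadratic_def
  proof (intro exI[of _ "\<lambda>u v. (\<alpha> * (fst u * fst v),
      a20 * (fst u * fst v) + (a11 + 2 * \<alpha>) * (fst u * snd v) + a02 * (snd u * snd v))"] conjI allI)
  qed (auto simp: bilinear_def linear_iff Q_def power2_eq_square algebra_simps)
  have eq: "(\<lambda>y. y + Q y + (0, r y)) = (\<lambda>y. (fst y + \<alpha> * (fst y)\<^sup>2,
      snd y + (a20 * (fst y)\<^sup>2 + (a11 + 2 * \<alpha>) * (fst y * snd y) + a02 * (snd y)\<^sup>2) + r y))" for r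
    by (simp add: Q_def prod_eq_iff fun_eq_iff)
  have eq0: "(\<lambda>y. y + Q y) = (\<lambda>y. (fst y + \<alpha> * (fst y)\<^sup>2,
      snd y + (a20 * (fst y)\<^sup>2 + (a11 + 2 * \<alpha>) * (fst y * snd y) + a02 * (snd y)\<^sup>2) + 0))"
    by (auto simp: Q_def prod_eq_iff)
  have 1: "\<exists>N Z. N \<subseteq> V \<and> local_coordinates (\<lambda>y. y + Q y) N \<and>
        vf_related (\<lambda>y. y + Q y) N (\<lambda>y. (Y1 y, Y2 y)) Z \<and> bt_field_mod_cubic a b Z"
    by (rule change[OF Ck_on_const[of 3 0] _ _ eq0]) auto
  have C_coord: "Ck_on 3 (\<lambda>y::real\<times>real. fst y) V" "Ck_on 3 (\<lambda>y::real\<times>real. snd y) V"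
    using V by (auto intro!: Ck_on_bounded_linear bounded_linear_fst bounded_linear_snd)
  have "Ck_on 3 (\<lambda>y. Y1 y + 2 * \<alpha> * fst y * Y1 y + (-1) * snd y
      + (-1) * (a20 * (fst y * fst y) + (a11 + 2 * \<alpha>) * (fst y * snd y) + a02 * (snd y * snd y))) V"
    by (intro Ck_on_add Ck_on_bilinear[OF bounded_bilinear_mult] Ck_on_const C_coord C3 V)
  then have r2_C3: "Ck_on 3 r2 V"
    by (rule back_subst[where P="\<lambda>f. Ck_on 3 f V"]) (simp add: fun_eq_iff r2_def power2_eq_square)
  \<comment> \<open>r2 is the cubic remainder of Y1 plus 2 alpha y1 (Y1 - y2), a product of orders 1
    and 2.\<close>
  have r2_O: "r2 \<in> O[at 0](norm_pow 3)"
  proof -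
    note mult = bigo_norm_mult
    have mono: "f \<in> O[at 0](norm_pow 2)" if "f \<in> O[at 0](norm_pow 3)" for f :: "real \<times> real \<Rightarrow> real"
      using that by (rule bigo_norm_mono) simp
    note y1 = fst_snd_bigo_norm(1) and y2 = fst_snd_bigo_norm(2)
    have q: "(\<lambda>y. a20 * (fst y)\<^sup>2 + a11 * (fst y * snd y) + a02 * (snd y)\<^sup>2) \<in> O[at 0](norm_pow 2)"
      using mult[OF y1 y1, of 2] mult[OF y1 y2, of 2] mult[OF y2 y2, of 2]
      unfolding power2_eq_square by (intro sum_in_bigo) simp_all
    have "(\<lambda>y. Y1 y - snd y) \<in> O[at 0](norm_pow 2)"
      using sum_in_bigo(1)[OF mono[OF Y1] q] by (simp add: algebra_simps)
    from mult[OF y1 this, of 3] have "(\<lambda>y. 2 * \<alpha> * (fst y * (Y1 y - snd y))) \<in> O[at 0](norm_pow 3)"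
      by simp
    from sum_in_bigo(1)[OF Y1 this] show ?thesis
      by (simp add: r2_def[abs_def] algebra_simps power2_eq_square)
  qed
  have r2_0: "r2 0 = 0" by (simp add: r2_def Y10)
  obtain N Z where NZ: "N \<subseteq> V" "local_coordinates (\<lambda>y. y + Q y + (0, r2 y)) N"
    "vf_related (\<lambda>y. y + Q y + (0, r2 y)) N (\<lambda>y. (Y1 y, Y2 y)) Z" "bt_field_mod_cubic a b Z"
    "\<forall>y\<in>N. fst (Z (y + Q y + (0, r2 y))) = Y1 y + 2 * \<alpha> * fst y * Y1 y"
    by (rule change[OF r2_C3 r2_O r2_0 eq])
  have "\<forall>u\<in>(\<lambda>y. y + Q y + (0, r2 y)) ` N. fst (Z u) = snd u"
    using NZ(5) by (auto simp: r2_def Q_def)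
  moreover have "(\<lambda>y. norm (0 :: real, r2 y)) \<in> O[at 0](norm_pow 3)"
    using r2_O by (simp add: norm_Pair)
  ultimately have 2: "\<exists>r N Z. N \<subseteq> V \<and> (\<lambda>y. norm (r y)) \<in> O[at 0](norm_pow 3) \<and>
        local_coordinates (\<lambda>y. y + Q y + r y) N \<and>
        vf_related (\<lambda>y. y + Q y + r y) N (\<lambda>y. (Y1 y, Y2 y)) Z \<and>
        (\<forall>u\<in>(\<lambda>y. y + Q y + r y) ` N. fst (Z u) = snd u) \<and> bt_field_mod_cubic a b Z"
    using NZ(1-4) by (intro exI[of _ "\<lambda>y. (0, r2 y)"] exI[of _ N] exI[of _ Z] conjI)
  show ?thesis
    unfolding bt_normal_form_def norm_pow_def[symmetric]
    by (rule exI[of _ Q], intro conjI) (rule Q, rule 1, rule 2)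
qed

section \<open>Restriction to a centre manifold\<close>

lemma Ck_on_2_of_3: "Ck_on 3 f S \<Longrightarrow> Ck_on 2 f S"
  by (erule Ck_on_mono) simp

text \<open>Taylor's formula and symmetry were proved for real-valued functions; composing X with a
  covector makes them applicable.\<close>

lemma dir_deriv_linear_functional:
  fixes X :: "real^'n \<Rightarrow> real^'n" and \<phi> :: "real^'n \<Rightarrow> real"
  assumes "linear \<phi>" "open U" "Ck_on 2 X U" "p \<in> U"
  shows "dir_deriv v (\<lambda>z. \<phi> (X z)) p = \<phi> (jacobian X (at p) *v v)"
    and "dir_deriv u (dir_deriv v (\<lambda>z. \<phi> (X z))) p = \<phi> (second_derivative X p u v)"
proof -
  note bl = linear_conv_bounded_linear[THEN iffD1, OF assms(1)]
  note d = Ck_on_2_differentiable[OF assms(3)]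
  have first: "dir_deriv v (\<lambda>z. \<phi> (X z)) x = \<phi> (frechet_derivative X (at x) v)" if "x \<in> U" for x v
    using frechet_derivative_at[OF bounded_linear.has_derivative[OF bl
          has_derivative_frechet_derivative[OF d(1)[OF that]]]]
    by (simp add: dir_deriv_def fun_eq_iff)
  have "((\<lambda>h. jacobian X (at p) *v h)) = frechet_derivative X (at p)"
    by (rule frechet_derivative_at) (use jacobian_works[of X "at p"] d(1)[OF assms(4)] in blast)
  then show "dir_deriv v (\<lambda>z. \<phi> (X z)) p = \<phi> (jacobian X (at p) *v v)"
    using first[OF assms(4)] by (simp add: fun_eq_iff)
  have "((\<lambda>z. \<phi> (frechet_derivative X (at z) v)) has_derivative (\<lambda>u. \<phi> (second_derivative X p u v))) (at p)"
    unfolding second_derivative_def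
    by (rule bounded_linear.has_derivative[OF bl has_derivative_frechet_derivative[OF d(2)[OF assms(4)]]])
  then have "(dir_deriv v (\<lambda>z. \<phi> (X z)) has_derivative (\<lambda>u. \<phi> (second_derivative X p u v))) (at p)"
    by (rule has_derivative_transform_within_open[OF _ assms(2,4)]) (simp add: first)
  from frechet_derivative_at[OF this] show "dir_deriv u (dir_deriv v (\<lambda>z. \<phi> (X z))) p = \<phi> (second_derivative X p u v)"
    by (simp add: dir_deriv_def[of u] fun_eq_iff)
qed

lemma bilinear_second_derivative:
  fixes X :: "real^'n \<Rightarrow> real^'n" and \<phi> :: "real^'n \<Rightarrow> real"
  assumes "linear \<phi>" "open U" "Ck_on 2 X U" "p \<in> U"
  shows "bilinear (\<lambda>u v. \<phi> (second_derivative X p u v))"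
proof -
  have "linear (\<lambda>u. second_derivative X p u v)" for v
    unfolding second_derivative_def
    by (rule linear_frechet_derivative[OF Ck_on_2_differentiable(2)[OF assms(3,4)]])
  moreover have "linear (second_derivative X p u)" for u
    by (rule linear_second_derivative[OF assms(2-4)])
  ultimately show ?thesis
    using assms(1) by (simp add: bilinear_def linear_iff)
qed

text \<open>In each component the constant and linear Taylor terms vanish at 0, and the norm is at
  most the sum of the absolute components.\<close>

lemma norm_bigo_square:
  fixes h :: "'a::euclidean_space \<Rightarrow> real^'n"
  assumes "open V" "0 \<in> V" "Ck_on 2 h V" "h 0 = 0" "(h has_derivative (\<lambda>_. 0)) (at 0)"
  shows "(\<lambda>y. norm (h y)) \<in> O[at 0](norm_pow 2)"
proof -
  have comp: "(\<lambda>y. h y $ i) \<in> O[at 0](norm_pow 2)" for i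
  proof -
    have C2: "Ck_on 2 (\<lambda>y. h y $ i) V"
      by (rule Ck_on_linear_compose[OF bounded_linear_vec_nth assms(1,3)])
    have "((\<lambda>y. h y $ i) has_derivative (\<lambda>_. 0 $ i)) (at 0)"
      by (rule bounded_linear.has_derivative[OF bounded_linear_vec_nth assms(5)])
    from frechet_derivative_at[OF this] have "dir_deriv w (\<lambda>y. h y $ i) 0 = 0" for w
      by (simp add: dir_deriv_def fun_eq_iff)
    then have sum0: "(\<Sum>j<2. (dir_deriv w ^^ j) (\<lambda>y. h y $ i) 0 / fact j) = 0" for w
      by (simp add: numeral_2_eq_2 assms(4))
    obtain M r where M: "M \<ge> 0" "r > 0"
      "\<forall>w. norm w \<le> r \<longrightarrow> \<bar>h (0 + w) $ i - (\<Sum>j<2. (dir_deriv w ^^ j) (\<lambda>y. h y $ i) 0 / fact j)\<bar> \<le> M * norm w ^ 2"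
      by (rule Taylor_bound[OF assms(1) C2 _ assms(2)]) simp
    have "\<bar>h w $ i\<bar> \<le> M * norm w ^ 2" if "norm w \<le> r" for w
      using M(3)[rule_format, OF that] unfolding sum0 by simp
    then have "\<forall>\<^sub>F y in at 0. norm (h y $ i) \<le> M * norm (norm_pow 2 y)"
      unfolding eventually_at norm_pow_def using M(2) by (intro exI[of _ r]) auto
    then show ?thesis by (rule bigoI)
  qed
  have "(\<lambda>y. \<Sum>i\<in>UNIV. \<bar>h y $ i\<bar>) \<in> O[at 0](norm_pow 2)"
    using comp by (intro big_sum_in_bigo) simp
  moreover have "(\<lambda>y. norm (h y)) \<in> O[at 0](\<lambda>y. \<Sum>i\<in>UNIV. \<bar>h y $ i\<bar>)"
    by (rule bigoI[where c=1], rule always_eventually)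
      (simp add: norm_le_l1_cart sum_nonneg)
  ultimately show ?thesis by (rule landau_o.big_trans[rotated])
qed

lemma bilinear_bigo:
  fixes A :: "'b::euclidean_space \<Rightarrow> 'b \<Rightarrow> real"
  assumes "bilinear A" "(\<lambda>y. norm (u y)) \<in> O[at 0](norm_pow m)" "(\<lambda>y. norm (v y)) \<in> O[at 0](norm_pow l)"
    and "m + l = k"
  shows "(\<lambda>y. A (u y) (v y)) \<in> O[at 0](norm_pow k)"
proof -
  obtain K where K: "\<And>x y. norm (A x y) \<le> K * norm x * norm y"
    using bilinear_bounded[OF assms(1)] by blast
  have "(\<lambda>y. A (u y) (v y)) \<in> O[at 0](\<lambda>y. norm (u y) * norm (v y))"
    by (rule bigoI[where c=K], rule always_eventually) (use K in \<open>simp add: mult.assoc\<close>)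
  then show ?thesis
    by (rule landau_o.big_trans) (rule bigo_norm_mult[OF assms(2-4)])
qed

text \<open>One statement serves both covectors: \<phi> q0 is 1 for p0 and 0 for p1. Hypothesis
  \<open>h_tr\<close> removes h from the linear term, where it would otherwise contribute at second
  order.\<close>

lemma functional_on_graph:
  fixes X :: "real^'n \<Rightarrow> real^'n" and \<phi> :: "real^'n \<Rightarrow> real" and h :: "real \<times> real \<Rightarrow> real^'n"
  assumes \<phi>: "linear \<phi>" and U: "open U" "Ck_on 3 X U" "p \<in> U" "X p = 0"
    and V: "open V" "0 \<in> V"
    and h: "Ck_on 3 h V" "h 0 = 0" "(h has_derivative (\<lambda>_. 0)) (at 0)"
    and h_tr: "\<And>y. y \<in> V \<Longrightarrow> \<phi> (jacobian X (at p) *v h y) = 0"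
    and q: "jacobian X (at p) *v q0 = 0" "jacobian X (at p) *v q1 = q0"
  defines "A \<equiv> \<lambda>u v. \<phi> (second_derivative X p u v)"
  shows "(\<lambda>y. \<phi> (X (graph_param p q0 q1 h y)) - (\<phi> q0 * snd y +
      (A q0 q0 / 2 * (fst y)\<^sup>2 + A q0 q1 * (fst y * snd y) + A q1 q1 / 2 * (snd y)\<^sup>2))) \<in> O[at 0](norm_pow 3)"
proof -
  note C2 = Ck_on_2_of_3[OF U(2)]
  note bl = linear_conv_bounded_linear[THEN iffD1, OF \<phi>]
  have C3: "Ck_on 3 (\<lambda>z. \<phi> (X z)) U"
    by (rule Ck_on_linear_compose[OF bl U(1,2)])
  have bil: "bilinear A"
    unfolding A_def by (rule bilinear_second_derivative[OF \<phi> U(1) C2 U(3)])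
  note add_r = bilinear_radd[OF bil] bilinear_ladd[OF bil] bilinear_rmul[OF bil] bilinear_lmul[OF bil]
  have sym: "A u v = A v u" for u v
    using dir_deriv_commute[OF U(1) Ck_on_2_of_3[OF C3] U(3)] unfolding dir_deriv_linear_functional(2)[OF \<phi> U(1) C2 U(3)] A_def .
  define lc where "lc y = fst y *\<^sub>R q0 + snd y *\<^sub>R q1" for y :: "real \<times> real"
  define w where "w y = lc y + h y" for y
  have g: "graph_param p q0 q1 h y = p + w y" for y
    by (simp add: graph_param_def w_def lc_def add.assoc)
  have lc_O: "(\<lambda>y. norm (lc y)) \<in> O[at 0](norm_pow 1)"
  proof -
    have "(\<lambda>y. norm (lc y)) \<in> O[at 0](\<lambda>y. \<bar>fst y\<bar> * norm q0 + \<bar>snd y\<bar> * norm q1)"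
      by (rule bigoI[where c=1], rule always_eventually)
        (auto simp: lc_def intro!: order_trans[OF norm_triangle_ineq])
    moreover have "(\<lambda>y. \<bar>fst y\<bar> * norm q0 + \<bar>snd y\<bar> * norm q1) \<in> O[at 0](norm_pow 1)"
      using fst_snd_bigo_norm by (intro sum_in_bigo) simp_all
    ultimately show ?thesis by (rule landau_o.big_trans)
  qed
  have h_O: "(\<lambda>y. norm (h y)) \<in> O[at 0](norm_pow 2)"
    by (rule norm_bigo_square[OF V Ck_on_2_of_3[OF h(1)] h(2,3)])
  have h_O1: "(\<lambda>y. norm (h y)) \<in> O[at 0](norm_pow 1)"
    by (rule bigo_norm_mono[OF h_O]) simp
  have w_O: "(\<lambda>y. norm (w y)) \<in> O[at 0](norm_pow 1)"
  proof -
    have "(\<lambda>y. norm (w y)) \<in> O[at 0](\<lambda>y. norm (lc y) + norm (h y))"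
      by (rule bigoI[where c=1], rule always_eventually) (simp add: w_def norm_triangle_ineq)
    then show ?thesis
      by (rule landau_o.big_trans) (intro sum_in_bigo lc_O h_O1)
  qed
  have w_lim: "(w \<longlongrightarrow> 0) (at 0)"
  proof -
    have "(h \<longlongrightarrow> 0) (at 0)"
      using has_derivative_continuous[OF h(3)] by (simp add: continuous_at h(2))
    moreover have "(lc \<longlongrightarrow> 0) (at 0)"
      unfolding lc_def by (auto intro!: tendsto_eq_intros)
    ultimately show ?thesis
      unfolding w_def by (auto intro!: tendsto_eq_intros)
  qed
  define R where "R v = \<phi> (X (p + v)) - \<phi> (jacobian X (at p) *v v) - A v v / 2" for v
  obtain M r where M: "M \<ge> 0" "r > 0"
    "\<forall>v. norm v \<le> r \<longrightarrow> \<bar>\<phi> (X (p + v)) - (\<Sum>j<3. (dir_deriv v ^^ j) (\<lambda>z. \<phi> (X z)) p / fact j)\<bar> \<le> M * norm v ^ 3"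
    by (rule Taylor_bound[OF U(1) C3 _ U(3)]) simp
  have "(\<Sum>j<3. (dir_deriv v ^^ j) (\<lambda>z. \<phi> (X z)) p / fact j) = \<phi> (jacobian X (at p) *v v) + A v v / 2" for v
    using dir_deriv_linear_functional[OF \<phi> U(1) C2 U(3)] U(4) linear_0[OF \<phi>]
    by (simp add: numeral_3_eq_3 A_def)
  then have R_bound: "\<bar>R v\<bar> \<le> M * norm v ^ 3" if "norm v \<le> r" for v
    using M(3)[rule_format, OF that] by (simp add: R_def)
  have R_O: "(\<lambda>y. R (w y)) \<in> O[at 0](norm_pow 3)"
  proof -
    have "\<forall>\<^sub>F y in at 0. norm (w y) < r"
      using w_lim M(2) by (auto simp: tendsto_iff dist_norm)
    then have "\<forall>\<^sub>F y in at 0. norm (R (w y)) \<le> M * norm (norm (w y) * (norm (w y) * norm (w y)))"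
    proof eventually_elim
      case (elim y)
      then show ?case using R_bound[of "w y"] by (simp add: power3_eq_cube mult.assoc)
    qed
    then have "(\<lambda>y. R (w y)) \<in> O[at 0](\<lambda>y. norm (w y) * (norm (w y) * norm (w y)))"
      by (rule bigoI)
    then show ?thesis
      by (rule landau_o.big_trans) (rule bigo_norm_mult[OF w_O bigo_norm_mult[OF w_O w_O refl]], simp)
  qed
  \<comment> \<open>The cross terms with h have orders 1 + 2; for A(h, h) it suffices to count one
    factor as O(|y|).\<close>
  have "(\<lambda>y. R (w y) + (A (lc y) (h y) + A (lc y) (h y) + A (h y) (h y)) / 2) \<in> O[at 0](norm_pow 3)"
    using bilinear_bigo[OF bil lc_O h_O, of 3] bilinear_bigo[OF bil h_O1 h_O, of 3]
    by (intro sum_in_bigo R_O) (simp add: sum_in_bigo)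
  moreover have "\<forall>\<^sub>F y in at 0. R (w y) + (A (lc y) (h y) + A (lc y) (h y) + A (h y) (h y)) / 2
    = \<phi> (X (graph_param p q0 q1 h y)) - (\<phi> q0 * snd y +
      (A q0 q0 / 2 * (fst y)\<^sup>2 + A q0 q1 * (fst y * snd y) + A q1 q1 / 2 * (snd y)\<^sup>2))"
    using eventually_at_in_open'[OF V]
  proof eventually_elim
    case (elim y)
    have "\<phi> (jacobian X (at p) *v w y) = \<phi> q0 * snd y"
      using h_tr[OF elim] q
      by (simp add: w_def lc_def matrix_vector_right_distrib matrix_vector_mult_scaleR
          linear_add[OF \<phi>] linear_scale[OF \<phi>] linear_0[OF \<phi>] mult.commute)
    moreover have "A (w y) (w y) = A (lc y) (lc y) + (A (lc y) (h y) + A (lc y) (h y) + A (h y) (h y))"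
      unfolding w_def add_r using sym[of "h y" "lc y"] by simp
    moreover have "A (lc y) (lc y) = A q0 q0 * (fst y)\<^sup>2 + 2 * (A q0 q1 * (fst y * snd y)) + A q1 q1 * (snd y)\<^sup>2"
      unfolding lc_def add_r using sym[of q1 q0] by (simp add: algebra_simps power2_eq_square)
    ultimately show ?case
      unfolding g R_def by (simp add: field_simps)
  qed
  ultimately show ?thesis
    by (rule landau_o.big.in_cong[THEN iffD1, rotated])
qed

text \<open>Invariance is given through solution curves, so tangency is derived from one. The curve
  x through a point of the graph stays on it, hence x = g(c) with c its (p0, p1)-coordinates;
  differentiating at time 0 in both forms gives the relation.\<close>

lemma centre_manifold_restriction:
  fixes X :: "real^'n \<Rightarrow> real^'n"
  assumes frame: "bt_frame (jacobian X (at p)) q0 q1 p0 p1"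
    and cm: "local_centre_manifold X U p q0 q1 V h"
  shows "vf_related (graph_param p q0 q1 h) V
    (\<lambda>y. (p0 (X (graph_param p q0 q1 h y)), p1 (X (graph_param p q0 q1 h y)))) X"
  unfolding vf_related_def
proof (intro ballI)
  fix y assume y: "y \<in> V"
  let ?g = "graph_param p q0 q1 h"
  let ?Y = "(p0 (X (?g y)), p1 (X (?g y)))"
  have p: "p0 q0 = 1" "p1 q1 = 1" "p0 q1 = 0" "p1 q0 = 0" "linear p0" "linear p1"
    using frame by (auto simp: bt_frame_def)
  note bl = p(5,6)[THEN linear_conv_bounded_linear[THEN iffD1]]
  have p_h: "p0 (h w) = 0 \<and> p1 (h w) = 0" if "w \<in> V" for w
    using frame cm that by (auto simp: bt_frame_def local_centre_manifold_def)
  have "(h has_derivative frechet_derivative h (at y)) (at y)"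
    using cm y Ck_on_has_derivative[of 3 h V y] unfolding local_centre_manifold_def by auto
  then have "(?g has_derivative (\<lambda>\<eta>. fst \<eta> *\<^sub>R q0 + snd \<eta> *\<^sub>R q1 + frechet_derivative h (at y) \<eta>)) (at y)"
    unfolding graph_param_def by (auto intro!: derivative_eq_intros)
  then have diff: "?g differentiable (at y)" by (rule differentiableI)
  then have Dg: "(?g has_derivative frechet_derivative ?g (at y)) (at y)"
    by (rule has_derivative_frechet_derivative)
  have "?g y \<in> ?g ` V" using y by blast
  moreover have "locally_invariant X (?g ` V)"
    using cm unfolding local_centre_manifold_def by blast
  ultimately have "\<exists>\<epsilon>>0. \<exists>x. x 0 = ?g y \<and>
      (\<forall>t\<in>{-\<epsilon><..<\<epsilon>}. (x has_vector_derivative X (x t)) (at t) \<and> x t \<in> ?g ` V)"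
    unfolding locally_invariant_def by (rule bspec[rotated])
  then obtain \<epsilon> x where x: "\<epsilon> > 0" "x 0 = ?g y"
    "\<forall>t\<in>{-\<epsilon><..<\<epsilon>}. (x has_vector_derivative X (x t)) (at t) \<and> x t \<in> ?g ` V"
    by blast
  define c where "c t = (p0 (x t - p), p1 (x t - p))" for t
  have coord: "(p0 (?g w - p), p1 (?g w - p)) = w" if "w \<in> V" for w
    using p_h[OF that] p
    by (simp add: graph_param_def add.assoc linear_add[OF p(5)] linear_add[OF p(6)]
        linear_scale[OF p(5)] linear_scale[OF p(6)])
  have x_c: "x t = ?g (c t)" if t: "t \<in> {-\<epsilon><..<\<epsilon>}" for t
  proof -
    obtain w where "w \<in> V" "x t = ?g w" using x(3) t by blast
    then show ?thesis using coord[of w] by (simp add: c_def)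
  qed
  have c0: "c 0 = y"
    using coord[OF y] by (simp add: c_def x(2))
  have xd: "(x has_vector_derivative X (?g y)) (at 0)"
    using x(1,2) bspec[OF x(3), of 0] by simp
  then have "((\<lambda>t. x t - p) has_vector_derivative X (?g y)) (at 0)"
    by (auto intro!: derivative_eq_intros)
  then have "(c has_vector_derivative ?Y) (at 0)"
    unfolding c_def by (intro has_vector_derivative_Pair bounded_linear.has_vector_derivative[OF bl(1)]
        bounded_linear.has_vector_derivative[OF bl(2)])
  then have "(c has_derivative (\<lambda>t. t *\<^sub>R ?Y)) (at 0)"
    by (simp add: has_vector_derivative_def)
  then have "((\<lambda>t. ?g (c t)) has_derivative (\<lambda>t. frechet_derivative ?g (at y) (t *\<^sub>R ?Y))) (at 0)"
    by (rule has_derivative_compose) (simp add: c0 Dg)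
  then have "((\<lambda>t. ?g (c t)) has_vector_derivative frechet_derivative ?g (at y) ?Y) (at 0)"
    unfolding has_vector_derivative_def linear_scale[OF has_derivative_linear[OF Dg]] .
  then have "(x has_vector_derivative frechet_derivative ?g (at y) ?Y) (at 0)"
    by (rule has_vector_derivative_transform_within_open[where S="{-\<epsilon><..<\<epsilon>}"]) (use x(1) x_c in auto)
  then have "frechet_derivative ?g (at y) ?Y = X (?g y)"
    using xd by (rule vector_derivative_unique_at)
  with diff show "?g differentiable (at y) \<and> frechet_derivative ?g (at y) ?Y = X (?g y)"
    by simp
qed

lemma centre_manifold_normal_form:
  fixes X :: "real^'n \<Rightarrow> real^'n"
  assumes frame: "bt_frame (jacobian X (at p)) q0 q1 p0 p1"
    and J_q0: "jacobian X (at p) *v q0 = 0"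
    and U: "open U" "Ck_on 3 X U" "p \<in> U" "X p = 0"
    and cm: "local_centre_manifold X U p q0 q1 V h"
  shows "bt_normal_form (1/2 * p1 (second_derivative X p q0 q0))
    (p0 (second_derivative X p q0 q0) + p1 (second_derivative X p q0 q1))
    (\<lambda>y. (p0 (X (graph_param p q0 q1 h y)), p1 (X (graph_param p q0 q1 h y)))) V"
proof -
  let ?J = "jacobian X (at p)" and ?g = "graph_param p q0 q1 h"
  have V: "open V" "0 \<in> V" and h: "Ck_on 3 h V" "h 0 = 0" "(h has_derivative (\<lambda>_. 0)) (at 0)"
    and h_tr: "\<And>y. y \<in> V \<Longrightarrow> h y \<in> E_tr ?J" and gU: "?g ` V \<subseteq> U"
    using cm unfolding local_centre_manifold_def by blast+
  have p: "p0 q0 = 1" "p1 q0 = 0" "linear p0" "linear p1" and q1: "?J *v q1 = q0"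
    and p_tr: "\<And>v. v \<in> E_tr ?J \<Longrightarrow> p0 v = 0 \<and> p1 v = 0"
    using frame unfolding bt_frame_def by blast+
  have "?J *v v \<in> E_tr ?J" if "v \<in> E_tr ?J" for v
    using that by (auto simp: E_tr_def)
  then have p_Jh: "p0 (?J *v h y) = 0" "p1 (?J *v h y) = 0" if "y \<in> V" for y
    using p_tr h_tr[OF that] by blast+
  have C_coord: "Ck_on 3 (\<lambda>y::real\<times>real. fst y) V" "Ck_on 3 (\<lambda>y::real\<times>real. snd y) V"
    by (rule Ck_on_bounded_linear[OF bounded_linear_fst V(1)], rule Ck_on_bounded_linear[OF bounded_linear_snd V(1)])
  have "Ck_on 3 ?g V"
    unfolding graph_param_def[abs_def]
    by (intro Ck_on_add V(1) Ck_on_const h(1) Ck_on_bilinear[OF bounded_bilinear_scaleR] C_coord)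
  then have "Ck_on 3 (\<lambda>y. X (?g y)) V"
    by (rule Ck_on_compose[OF V(1) U(1) gU U(2)])
  then have C3: "Ck_on 3 (\<lambda>y. p0 (X (?g y))) V"
    by (rule Ck_on_linear_compose[OF linear_conv_bounded_linear[THEN iffD1, OF p(3)] V(1)])
  have "?g 0 = p" by (simp add: graph_param_def h(2))
  then have zero: "p0 (X (?g 0)) = 0" using U(4) linear_0[OF p(3)] by simp
  note O0 = functional_on_graph[OF p(3) U V h p_Jh(1) J_q0 q1]
  note O1 = functional_on_graph[OF p(4) U V h p_Jh(2) J_q0 q1]
  show ?thesis
  \<comment> \<open>Here \<open>a20\<close> = p0 B(q0,q0) / 2, \<open>b20\<close> = p1 B(q0,q0) / 2
    and \<open>b11\<close> = p1 B(q0,q1), so \<open>b20\<close> and 2 \<open>a20\<close> +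
    \<open>b11\<close> are the two Bogdanov-Takens coefficients.\<close>
  proof (rule planar_normal_form[OF V C3 zero])
    show "(\<lambda>y. p0 (X (?g y)) - (snd y + p0 (second_derivative X p q0 q0) / 2 * (fst y)\<^sup>2
        + p0 (second_derivative X p q0 q1) * (fst y * snd y)
        + p0 (second_derivative X p q1 q1) / 2 * (snd y)\<^sup>2)) \<in> O[at 0](norm_pow 3)"
      using O0 by (simp add: p add.assoc)
    show "(\<lambda>y. p1 (X (?g y)) - (p1 (second_derivative X p q0 q0) / 2 * (fst y)\<^sup>2
        + p1 (second_derivative X p q0 q1) * (fst y * snd y)
        + p1 (second_derivative X p q1 q1) / 2 * (snd y)\<^sup>2)) \<in> O[at 0](norm_pow 3)"
      using O1 by (simp add: p)
  qed simp_all
qed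

theorem theorem4p1:
  fixes X :: "real^'n \<Rightarrow> real^'n" and U :: "(real^'n) set" and p q0 :: "real^'n"
    and J :: "real^'n^'n" and a b :: real and n :: int and e De :: "int \<Rightarrow> real"
  assumes "CARD('n) \<ge> 2"
    and "open U" and "Ck_on 2 X U" and "p \<in> U" and "X p = 0"
    and "n = int CARD('n)"
    and "J = jacobian X (at p)"
    and "e = (\<lambda>k. e_sum k J)"
    and "De = (\<lambda>k. deriv (\<lambda>s::real. e_sum k (jacobian X (at (p + s *\<^sub>R q0)))) 0)"
    and "int (rank J) = n - 1" and "e (n - 1) = 0" and "e (n - 2) \<noteq> 0"
    and "span {q0} = {v. J *v v = 0}"
    and "(a, b) = bt_coeffs X p q0"
  shows "(\<forall>k. (\<lambda>s::real. e_sum k (jacobian X (at (p + s *\<^sub>R q0)))) field_differentiable (at 0)) \<and>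
     De n = - 2 * a * e (n - 2) \<and>
     De (n - 1) = b * e (n - 2) - 2 * a * e (n - 3) \<and>
     a = - (1/2) * (De n / e (n - 2)) \<and>
     b = De (n - 1) / e (n - 2) - e (n - 3) * De n / (e (n - 2))\<^sup>2 \<and>
     (Ck_on 3 X U \<and> hyperbolic_on J (E_tr J) \<longrightarrow>
       (\<forall>q1 V h. q1 \<in> E_c J \<and> J *v q1 = q0 \<and> local_centre_manifold X U p q0 q1 V h \<longrightarrow>
         (\<exists>Y. vf_related (graph_param p q0 q1 h) V Y X \<and> bt_normal_form a b Y V)))"
proof -
  interpret bt: bt_field J q0 X U p
    using assms by unfold_locales auto
  have De_eq: "De k = bt.De k" for k
    by (simp add: assms(9) bt.De_def)
  obtain q1 where "J *v q1 = q0" by (rule bt.q1_exists)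
  then obtain p0 p1 where frame: "bt_frame J q0 q1 p0 p1"
    by (rule bt.frame_exists)
  have ab: "a = 1/2 * p1 (second_derivative X p q0 q0)"
    "b = p0 (second_derivative X p q0 q0) + p1 (second_derivative X p q0 q1)"
    using assms(14) bt.bt_coeffs_eq[OF frame] by simp_all
  have D0: "De n = - 2 * a * e (n - 2)" and D1: "De (n - 1) = b * e (n - 2) - 2 * a * e (n - 3)"
    using bt.derivative_formulas[OF frame] by (simp_all add: De_eq ab assms(6,8))
  have a: "a = - (1/2) * (De n / e (n - 2))"
    using assms(12) by (simp add: D0)
  have b: "b = De (n - 1) / e (n - 2) - e (n - 3) * De n / (e (n - 2))\<^sup>2"
    using assms(12) by (simp add: D0 D1 field_simps power2_eq_square)
  have normal_form: "\<exists>Y. vf_related (graph_param p q0 q1 h) V Y X \<and> bt_normal_form a b Y V"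
    if C3: "Ck_on 3 X U" and q1: "J *v q1 = q0" and cm: "local_centre_manifold X U p q0 q1 V h" for q1 V h
  proof -
    \<comment> \<open>This q1 is arbitrary, not the one chosen above; \<open>bt_coeffs_eq\<close>
      expresses the same (a, b) in its frame.\<close>
    obtain p0 p1 where frame: "bt_frame J q0 q1 p0 p1"
      by (rule bt.frame_exists[OF q1])
    have ab: "a = 1/2 * p1 (second_derivative X p q0 q0)"
      "b = p0 (second_derivative X p q0 q0) + p1 (second_derivative X p q0 q1)"
      using assms(14) bt.bt_coeffs_eq[OF frame] by simp_all
    note frame' = frame[unfolded assms(7)]
    show ?thesis
      using centre_manifold_restriction[OF frame' cm]
        centre_manifold_normal_form[OF frame' bt.J_q0[unfolded assms(7)] assms(2) C3 assms(4,5) cm]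
      unfolding ab by blast
  qed
  show ?thesis
    using bt.e_sum_line_differentiable D0 D1 a b normal_form by blast
qed

end
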